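(* Suppose $\beta=(0,0,|\beta|)\ne0$ and that $\chi$ vanishes in a neighborhood of $0$, say $\chi(|k|)=0$ for $|k|\le\rho$ with $\rho>0$. Let $u_0=\Psi_0\otimes a_\emptyset$, $\lambda_1=-N|\beta|$, let $u_1=-(K_1-\lambda_1)^{-1}K_{3/2}u_0$, that is, $u_1\in\mathcal F_{odd}(\rho)\otimes\mathcal H_{sp}$ satisfies $(K_1-\lambda_1)u_1+K_{3/2}u_0=0$, and let $\lambda_2=\langle K_{3/2}u_1,u_0\rangle$ (the second coefficient of the expansion $\lambda_1h+\lambda_2h^2+\cdots$ of the approximate eigenvalue of the quasimode $u_0+h^{1/2}u_1+\cdots$). Then $$\lambda_2=-\langle (K_1-\lambda_1)^{-1}K_{3/2}u_0,K_{3/2}u_0\rangle=-\sum_{\lambda,\mu\le N}\ \sum_{m,n\le3}C_{mn}^{[\lambda,\mu]},$$ $$C_{mn}^{[\lambda,\mu]}=\Big\langle (K_1-\lambda_1)^{-1}\big(\Phi_S(a_m(x_\lambda)+ib_m(x_\lambda))\Psi_0\otimes\sigma_m^{[\lambda]}a_\emptyset\big),\ \Phi_S(a_n(x_\mu)+ib_n(x_\mu))\Psi_0\otimes\sigma_n^{[\mu]}a_\emptyset\Big\rangle .$$ The bracket $C_{mn}^{[\lambda,\mu]}$ is zero except if $m=n=3$, or if $m\le2$, $n\le2$ and $\lambda=\mu$. In the first case $$C_{33}^{[\lambda,\mu]}=(2\pi)^{-3}\int_{\mathbb R^3}\chi(|k|)^2\cos(k\cdot(x_\lambda-x_\mu))\,\frac{k_1^2+k_2^2}{|k|^2}\,dk,$$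 and in the second case $$C_{mn}^{[\lambda,\lambda]}=\langle\sigma_m^{[\lambda]}a_\emptyset,\sigma_n^{[\lambda]}a_\emptyset\rangle\,(2\pi)^{-3}\int_{\mathbb R^3}\frac{\chi(|k|)^2|k|}{|k|+2|\beta|}\,\frac{(k\wedge e_m)\cdot(k\wedge e_n)}{|k|^2}\,dk,$$ the last integral being zero if $m\ne n$. Consequently, setting $C=C_{11}^{[\lambda,\lambda]}$, $$\lambda_2=-2NC-\sum_{\lambda,\mu\le N}C_{33}^{[\lambda,\mu]}.$$
   Context: $H$ is the real Hilbert space of $f=(f_1,f_2,f_3):\mathbb R^3\to\mathbb R^3$ with $f_j\in L^2(\mathbb R^3)$ real valued and $k\cdot f(k)=0$ a.e., with the $L^2$ norm; $H_{\mathbb C}$ is its complexification; $\mathcal F_s(H_{\mathbb C})=\oplus_{m\ge0}\mathcal F_m$ is the symmetric Fock space, $\mathcal F_m$ the $m$-particle sector, whose elements are viewed as symmetric functions of $(k_1,\dots,k_m)\in(\mathbb R^3)^m$; $\Psi_0$ is the vacuum (unit vector of $\mathcal F_0=\mathbb C$). $\mathcal F_m(\rho)$ is the set of $f\in\mathcal F_m$ with $f(k_1,\dots,k_m)=0$ whenever some $|k_j|\le\rho$, and $\mathcal F_{odd}(\rho)=\mathcal F_1(\rho)\oplus\mathcal F_3(\rho)\oplus\cdots$ (finite sums). $M$ is multiplication by $|k|$. $\Phi_S(f)$, $f\in H_{\mathbb C}$, is the Segal field operator as defined in Reed and Simon. $\chi\in\mathcal S(\mathbb R)$ is real valued; $(e_1,e_2,e_3)$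 is the canonical basis of $\mathbb R^3$; $\wedge$ is the cross product. For $x\in\mathbb R^3$, $m=1,2,3$, $$a_m(x)(k)=\frac{\chi(|k|)|k|^{1/2}}{(2\pi)^{3/2}}\sin(k\cdot x)\frac{k\wedge e_m}{|k|},\qquad b_m(x)(k)=\frac{\chi(|k|)|k|^{1/2}}{(2\pi)^{3/2}}\cos(k\cdot x)\frac{k\wedge e_m}{|k|}.$$ $x_1,\dots,x_N\in\mathbb R^3$ (positions of the $N$ fixed spin-$1/2$ particles) and the constant magnetic field $\beta=(\beta_1,\beta_2,\beta_3)$ are fixed; $\mathcal H_{sp}=(\mathbb C^2)^{\otimes N}$; $\sigma_m^{[\lambda]}$ is the Pauli matrix $\sigma_m$ acting on the $\lambda$-th factor; $$K_1=d\Gamma(M)\otimes I+I\otimes\sum_{\lambda,m}\beta_m\sigma_m^{[\lambda]},\qquad K_{3/2}=\sum_{\lambda,m}\Phi_S(a_m(x_\lambda)+ib_m(x_\lambda))\otimes\sigma_m^{[\lambda]},$$ so that the Hamiltonian of the system is $hK_1+h^{3/2}K_{3/2}$, with $h>0$ the semiclassical parameter. $b_0\in\mathbb C^2$ is a unit vector with $\sum_m\beta_m\sigma_mb_0=-|\beta|b_0$, and $a_\emptyset=b_0\otimes\cdots\otimes b_0$. For $f\in\mathcal F_{odd}(\rho)\otimes\mathcal H_{sp}$, $(K_1-\lambda_1)^{-1}f$ denotes the element $u\in\mathcal F_{odd}(\rho)\otimes\mathcal H_{sp}$ with $(K_1-\lambda_1)u=f$.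
   Formalization: The integral formulas for C_33 and for C_mn (m,n ≤ 2) carry an additional factor 1/2: with the Segal field of Reed and Simon, Φ_S(f)Ψ_0 = f/√2, so the printed constants are too large by a factor 2 whenever χ is not zero on (0,∞). *)

theory Defs
  imports "HOL-Analysis.Analysis"
begin

section \<open>Symmetric Fock space over the transverse one-particle space\<close>

text \<open>
  A function of \<open>k\<close> with values in \<open>C^3\<close> is written as a scalar function of a pair
  \<open>(k, j)\<close>, where \<open>j\<close> is a component index. The \<open>m\<close>-particle sector then consists of
  scalar functions of \<open>p 0, \<dots>, p (m-1)\<close> with \<open>p i = (k_i, j_i)\<close>, square integrable for
  the product measure below. Vectors are represented by functions, and equality of
  vectors is equality almost everywhere in every sector.
\<close>

type_synonym mode = "(real^3) \<times> 3"

type_synonym fock = "nat \<Rightarrow> (nat \<Rightarrow> mode) \<Rightarrow> complex"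

definition mode_measure :: "mode measure" where
  "mode_measure = lborel \<Otimes>\<^sub>M count_space UNIV"

definition sector_measure :: "nat \<Rightarrow> (nat \<Rightarrow> mode) measure" where
  "sector_measure m = PiM {..<m} (\<lambda>_. mode_measure)"

text \<open>The last three conditions: square integrability, symmetry, and \<open>k \<cdot> f(k) = 0\<close> in each variable.\<close>

definition fock_sector :: "nat \<Rightarrow> ((nat \<Rightarrow> mode) \<Rightarrow> complex) set" where
  "fock_sector m = {f. f \<in> borel_measurable (sector_measure m)
     \<and> integrable (sector_measure m) (\<lambda>p. (norm (f p))\<^sup>2)
     \<and> (\<forall>\<pi>. \<pi> permutes {..<m} \<longrightarrow> (AE p in sector_measure m. f (p \<circ> \<pi>) = f p))
     \<and> (\<forall>i<m. AE p in sector_measure m.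
           (\<Sum>j\<in>UNIV. of_real (fst (p i) $ j) * f (p(i := (fst (p i), j)))) = 0)}"

definition fock_sector_cut :: "real \<Rightarrow> nat \<Rightarrow> ((nat \<Rightarrow> mode) \<Rightarrow> complex) set" where
  "fock_sector_cut \<rho> m = {f \<in> fock_sector m.
     AE p in sector_measure m. (\<exists>i<m. norm (fst (p i)) \<le> \<rho>) \<longrightarrow> f p = 0}"

definition fock_odd :: "real \<Rightarrow> fock set" where
  "fock_odd \<rho> = {\<psi>. (\<forall>m. \<psi> m \<in> fock_sector_cut \<rho> m)
     \<and> (\<forall>m. even m \<longrightarrow> (AE p in sector_measure m. \<psi> m p = 0))
     \<and> (\<exists>n. \<forall>m>n. AE p in sector_measure m. \<psi> m p = 0)}"

definition fock_inner :: "fock \<Rightarrow> fock \<Rightarrow> complex" where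
  "fock_inner \<phi> \<psi> = (\<Sum>m. LINT p|sector_measure m. cnj (\<phi> m p) * \<psi> m p)"

definition vacuum :: fock where
  "vacuum = (\<lambda>m p. if m = 0 then 1 else 0)"

text \<open>\<open>d\<Gamma>(A)\<close>: sum over \<open>i\<close> of \<open>A\<close> acting on the \<open>i\<close>-th variable.\<close>

definition second_quant :: "((mode \<Rightarrow> complex) \<Rightarrow> mode \<Rightarrow> complex) \<Rightarrow> fock \<Rightarrow> fock" where
  "second_quant A \<psi> = (\<lambda>m p. \<Sum>i<m. A (\<lambda>q. \<psi> m (p(i := q))) (p i))"

definition mult_abs :: "(mode \<Rightarrow> complex) \<Rightarrow> mode \<Rightarrow> complex" where
  "mult_abs f = (\<lambda>q. of_real (norm (fst q)) * f q)"

text \<open>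
  Annihilation and creation operators, in the form given by Reed and Simon (volume II,
  section X.7) for symmetric functions: the new variable is put in front, respectively
  the \<open>i\<close>-th variable is left out.
\<close>

definition annihilation :: "(mode \<Rightarrow> complex) \<Rightarrow> fock \<Rightarrow> fock" where
  "annihilation f \<psi> = (\<lambda>m p. of_real (sqrt (real (Suc m))) *
     (LINT q|mode_measure. cnj (f q) * \<psi> (Suc m) (case_nat q p)))"

definition creation :: "(mode \<Rightarrow> complex) \<Rightarrow> fock \<Rightarrow> fock" where
  "creation f \<psi> = (\<lambda>m p. of_real (1 / sqrt (real m)) *
     (\<Sum>i<m. f (p i) * \<psi> (m - 1) (\<lambda>j\<in>{..<m - 1}. p (if j < i then j else Suc j))))"

definition segal :: "(mode \<Rightarrow> complex) \<Rightarrow> fock \<Rightarrow> fock" where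
  "segal f \<psi> = (\<lambda>m p. of_real (1 / sqrt 2) * (annihilation f \<psi> m p + creation f \<psi> m p))"

text \<open>
  With this normalisation the field maps the vacuum to \<open>f / sqrt 2\<close>, so that a product of
  two fields contributes a factor \<open>1/2\<close> to vacuum expectations.
\<close>

lemma segal_vacuum:
  "segal f vacuum m p = (if m = 1 then of_real (1 / sqrt 2) * f (p 0) else 0)"
proof -
  have "annihilation f vacuum m p = 0"
    by (simp add: annihilation_def vacuum_def)
  moreover have "creation f vacuum m p = (if m = 1 then f (p 0) else 0)"
    by (cases "m = 0 \<or> m = 1") (auto simp: creation_def vacuum_def)
  ultimately show ?thesis
    by (simp add: segal_def)
qed


section \<open>Spins\<close>

text \<open>
  The particles are indexed by a finite type \<open>'n\<close>. An element of the \<open>N\<close>-fold tensor power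
  of \<open>C^2\<close> is given by its coordinates in the product basis, whose elements are the maps
  from \<open>'n\<close> to the index type \<open>2\<close>. In the types \<open>2\<close> and \<open>3\<close>, the last index is also \<open>0\<close>.
\<close>

type_synonym 'n spin = "('n \<Rightarrow> 2) \<Rightarrow> complex"

definition pauli :: "3 \<Rightarrow> complex^2^2" where
  "pauli m =
    (if m = 1 then vector [vector [0, 1], vector [1, 0]]
     else if m = 2 then vector [vector [0, - \<i>], vector [\<i>, 0]]
     else vector [vector [1, 0], vector [0, - 1]])"

definition spin_op :: "'n \<Rightarrow> 3 \<Rightarrow> 'n spin \<Rightarrow> 'n spin" where
  "spin_op l m a = (\<lambda>s. \<Sum>t\<in>UNIV. pauli m $ s l $ t * a (s(l := t)))"

definition spin_inner :: "'n::finite spin \<Rightarrow> 'n spin \<Rightarrow> complex" where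
  "spin_inner a b = (\<Sum>s\<in>UNIV. cnj (a s) * b s)"

definition spin_power :: "complex^2 \<Rightarrow> 'n::finite spin" where
  "spin_power b = (\<lambda>s. \<Prod>l\<in>UNIV. b $ s l)"

definition zeeman :: "real^3 \<Rightarrow> 'n::finite spin \<Rightarrow> 'n spin" where
  "zeeman \<beta> a = (\<lambda>s. \<Sum>l\<in>UNIV. \<Sum>m\<in>UNIV. of_real (\<beta> $ m) * spin_op l m a s)"


section \<open>The tensor product of Fock space and spin space\<close>

text \<open>As the spin space has finite dimension, a vector is given by its Fock space coordinates.\<close>

type_synonym 'n state = "('n \<Rightarrow> 2) \<Rightarrow> fock"

definition tensor :: "fock \<Rightarrow> 'n spin \<Rightarrow> 'n state" where
  "tensor \<psi> a = (\<lambda>s m p. \<psi> m p * a s)"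

definition tensor_op :: "(fock \<Rightarrow> fock) \<Rightarrow> ('n spin \<Rightarrow> 'n spin) \<Rightarrow> 'n state \<Rightarrow> 'n state" where
  "tensor_op A B \<Psi> = (\<lambda>s m p. B (\<lambda>t. A (\<Psi> t) m p) s)"

definition state_inner :: "'n::finite state \<Rightarrow> 'n state \<Rightarrow> complex" where
  "state_inner \<Phi> \<Psi> = (\<Sum>s\<in>UNIV. fock_inner (\<Phi> s) (\<Psi> s))"

definition state_eq :: "'n state \<Rightarrow> 'n state \<Rightarrow> bool" where
  "state_eq \<Phi> \<Psi> \<longleftrightarrow> (\<forall>s m. AE p in sector_measure m. \<Phi> s m p = \<Psi> s m p)"

definition odd_states :: "real \<Rightarrow> 'n state set" where
  "odd_states \<rho> = {\<Psi>. \<forall>s. \<Psi> s \<in> fock_odd \<rho>}"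


section \<open>The Hamiltonian\<close>

definition schwartz :: "(real \<Rightarrow> real) \<Rightarrow> bool" where
  "schwartz f \<longleftrightarrow> (\<forall>n x. (deriv ^^ n) f differentiable at x)
     \<and> (\<forall>i n. bounded (range (\<lambda>x. x ^ i * (deriv ^^ n) f x)))"

definition field_a :: "(real \<Rightarrow> real) \<Rightarrow> 3 \<Rightarrow> real^3 \<Rightarrow> real^3 \<Rightarrow> real^3" where
  "field_a chi m x k = (chi (norm k) * sqrt (norm k) / (2 * pi) powr (3/2) * sin (k \<bullet> x))
     *\<^sub>R (cross3 k (axis m 1) /\<^sub>R norm k)"

definition field_b :: "(real \<Rightarrow> real) \<Rightarrow> 3 \<Rightarrow> real^3 \<Rightarrow> real^3 \<Rightarrow> real^3" where
  "field_b chi m x k = (chi (norm k) * sqrt (norm k) / (2 * pi) powr (3/2) * cos (k \<bullet> x))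
     *\<^sub>R (cross3 k (axis m 1) /\<^sub>R norm k)"

definition complexify :: "(real^3 \<Rightarrow> real^3) \<Rightarrow> (real^3 \<Rightarrow> real^3) \<Rightarrow> mode \<Rightarrow> complex" where
  "complexify f g = (\<lambda>(k, j). Complex (f k $ j) (g k $ j))"

definition field :: "(real \<Rightarrow> real) \<Rightarrow> 3 \<Rightarrow> real^3 \<Rightarrow> fock \<Rightarrow> fock" where
  "field chi m x = segal (complexify (field_a chi m x) (field_b chi m x))"

definition K1 :: "real^3 \<Rightarrow> 'n::finite state \<Rightarrow> 'n state" where
  "K1 \<beta> \<Psi> = (\<lambda>s m p. tensor_op (second_quant mult_abs) (\<lambda>a. a) \<Psi> s m p
     + tensor_op (\<lambda>\<psi>. \<psi>) (zeeman \<beta>) \<Psi> s m p)"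

definition K32 :: "(real \<Rightarrow> real) \<Rightarrow> ('n::finite \<Rightarrow> real^3) \<Rightarrow> 'n state \<Rightarrow> 'n state" where
  "K32 chi x \<Psi> = (\<lambda>s n p. \<Sum>l\<in>UNIV. \<Sum>m\<in>UNIV.
     tensor_op (field chi m (x l)) (spin_op l m) \<Psi> s n p)"

definition K1_shift :: "real^3 \<Rightarrow> real \<Rightarrow> 'n::finite state \<Rightarrow> 'n state" where
  "K1_shift \<beta> z \<Psi> = (\<lambda>s m p. K1 \<beta> \<Psi> s m p - of_real z * \<Psi> s m p)"

text \<open>
  No separate condition says that \<open>u\<close> is in the domain of \<open>K1\<close>: it follows from the equation,
  as \<open>u\<close> and \<open>f\<close> are square integrable and the spin part of \<open>K1\<close> is bounded.
\<close>

definition resolvent :: "real \<Rightarrow> real^3 \<Rightarrow> real \<Rightarrow> 'n::finite state \<Rightarrow> 'n state" where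
  "resolvent \<rho> \<beta> z f = (SOME u. u \<in> odd_states \<rho> \<and> state_eq (K1_shift \<beta> z u) f)"

end

theory Submission
  imports Defs "HOL-Probability.Sinc_Integral"
begin

text \<open>
  For \<open>\<beta>\<close> along the third axis, \<open>K_1 - \<lambda>_1\<close> is diagonal in the product basis of the spins: it is
  multiplication by \<open>|k_1| + \<dots> + |k_m|\<close> plus \<open>2|\<beta>|\<close> times the number of spins pointing up. On
  odd sectors with the infrared cutoff this multiplier is at least \<open>\<rho>\<close>, so the resolvent is
  division by it. The field maps the vacuum to the one-particle sector, hence every bracket is an
  integral over one mode of \<open>cnj (a_m + i b_m) (a_n + i b_n)\<close> divided by \<open>|k|\<close> plus the
  spin gap, weighted by matrix elements of Pauli matrices. As \<open>\<sigma>_3\<close> preserves the ground spin while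
  \<open>\<sigma>_1, \<sigma>_2\<close> flip one spin, orthogonality leaves only the stated brackets. The phases combine to
  \<open>exp (i k \<cdot> (x_l - x_l'))\<close>, whose imaginary part integrates to zero by parity.
\<close>

section \<open>Integrals over the momentum space\<close>

text \<open>Vectors are functions taken up to null sets, and \<open>resolvent\<close> is an
  arbitrary choice among representatives, so it cannot be evaluated at a point.
  \<open>divide_energy\<close> is one explicit representative; every other choice agrees with it
  almost everywhere, and each bracket is computed by transferring an integral to it.
  \<open>K32 chi x u1\<close> also has a two-particle part, but it is paired only with the vacuum.
  Hence full symmetry of \<open>K32\<close> is not at stake: it suffices to move \<open>K32\<close>
  from a one-particle vector to the vacuum, where creation plays no part and annihilation is a
  single integral. The factor 1/2 in the formulas for \<open>C\<close> is the Segal normalisation, 1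
  / sqrt 2 from each of the two fields; the informal formulas for the brackets do not show it. The
  final expression for \<open>lam2\<close> is unaffected, being written in terms of the brackets
  themselves.\<close>

lemma integrable_prod_inverse_1_plus_square:
  "integrable lborel (\<lambda>k::'a::euclidean_space. \<Prod>b\<in>Basis. inverse (1 + (k \<bullet> b)\<^sup>2))"
proof (rule integrableI_bounded)
  have "integrable lborel (\<lambda>x::real. inverse (1 + x\<^sup>2))"
    using integrable_inverse_1_plus_square by (simp add: set_integrable_def einterval_def)
  then have fin: "(\<integral>\<^sup>+x. ennreal (inverse (1 + x\<^sup>2)) \<partial>(lborel::real measure)) < \<infinity>"
    by (simp add: integrable_iff_bounded)
  show "(\<lambda>k::'a. \<Prod>b\<in>Basis. inverse (1 + (k \<bullet> b)\<^sup>2)) \<in> borel_measurable lborel"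
    by measurable
  have "(\<integral>\<^sup>+k. ennreal (norm (\<Prod>b\<in>Basis. inverse (1 + (k \<bullet> b)\<^sup>2))) \<partial>(lborel :: 'a measure))
      = (\<integral>\<^sup>+k. (\<Prod>b\<in>Basis. ennreal (inverse (1 + (k \<bullet> b)\<^sup>2))) \<partial>(lborel :: 'a measure))"
    by (intro nn_integral_cong) (simp add: prod_ennreal abs_prod)
  also have "\<dots> = (\<Prod>b\<in>(Basis::'a set). (\<integral>\<^sup>+x. ennreal (inverse (1 + x\<^sup>2)) \<partial>lborel))"
    by (rule nn_integral_lborel_prod) auto
  also have "\<dots> < \<infinity>"
    using fin by (simp add: power_less_top_ennreal)
  finally show "(\<integral>\<^sup>+k. ennreal (norm (\<Prod>b\<in>Basis. inverse (1 + (k \<bullet> b)\<^sup>2))) \<partial>(lborel :: 'a measure)) < \<infinity>" .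
qed

lemma schwartz_measurable:
  assumes "schwartz f"
  shows "f \<in> borel_measurable borel"
proof -
  have "f differentiable at x" for x
    using assms unfolding schwartz_def by (metis funpow_0)
  then show ?thesis
    by (intro borel_measurable_continuous_onI)
      (auto intro!: differentiable_imp_continuous_on simp: differentiable_on_def)
qed

text \<open>The power 3 matches the three coordinate factors of the majorant on
  \<open>real^3\<close>; the factor \<open>\<bar>r\<bar>\<close> comes from squaring the
  \<open>sqrt (norm k)\<close> in the couplings.\<close>

lemma schwartz_decay:
  assumes "schwartz f"
  obtains c where "\<And>r. (f r)\<^sup>2 * \<bar>r\<bar> * (1 + r\<^sup>2) ^ 3 \<le> c"
proof -
  have "\<forall>i. \<exists>B. \<forall>r. \<bar>r ^ i * f r\<bar> \<le> B"
  proof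
    fix i
    have "bounded (range (\<lambda>r. r ^ i * (deriv ^^ 0) f r))"
      using assms unfolding schwartz_def by blast
    then show "\<exists>B. \<forall>r. \<bar>r ^ i * f r\<bar> \<le> B"
      by (auto simp: bounded_iff)
  qed
  then obtain B where B: "\<And>i r. \<bar>r ^ i * f r\<bar> \<le> B i"
    by metis
  \<comment> \<open>One more factor \<open>1 + r\<^sup>2\<close> absorbs
    \<open>\<bar>r\<bar>\<close>. What is left is the square of
    \<open>f r * (1 + r\<^sup>2)\<^sup>2\<close>, and the expansion 1 + 2 r^2 + r^4 dictates the
    combination of seminorms.\<close>
  have "(f r)\<^sup>2 * \<bar>r\<bar> * (1 + r\<^sup>2) ^ 3 \<le> (B 0 + 2 * B 2 + B 4)\<^sup>2" for r
  proof -
    have "\<bar>r\<bar> \<le> 1 + r\<^sup>2"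
      using zero_le_power2[of "\<bar>r\<bar> - 1"] zero_le_power2[of r] by (simp add: power2_diff)
    then have "(f r)\<^sup>2 * \<bar>r\<bar> * (1 + r\<^sup>2) ^ 3 \<le> (f r)\<^sup>2 * (1 + r\<^sup>2) * (1 + r\<^sup>2) ^ 3"
      by (intro mult_right_mono mult_left_mono) auto
    also have "\<dots> = \<bar>r ^ 0 * f r + 2 * (r ^ 2 * f r) + r ^ 4 * f r\<bar>\<^sup>2"
    proof -
      have "r ^ 0 * f r + 2 * (r ^ 2 * f r) + r ^ 4 * f r = f r * (1 + r\<^sup>2)\<^sup>2"
        by (simp add: power2_sum algebra_simps flip: power_mult)
      then show ?thesis
        by (simp add: power_mult_distrib power_abs flip: power_mult power_Suc mult.assoc)
    qed
    also have "\<dots> \<le> (B 0 + 2 * B 2 + B 4)\<^sup>2"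
      using B[of r 0] B[of r 2] B[of r 4] by (intro power_mono) linarith+
    finally show ?thesis .
  qed
  then show thesis
    by (rule that)
qed

text \<open>Up to constants this weight bounds the squared couplings. In place of polar coordinates,
  it is compared with a product of one-variable functions: each
  \<open>1 + (k \<bullet> b)\<^sup>2\<close> is at most \<open>1 + (norm k)\<^sup>2\<close>, and
  Tonelli integrates the product one coordinate at a time.\<close>

lemma integrable_schwartz_weight:
  assumes "schwartz f"
  shows "integrable lborel (\<lambda>k::real^3. (f (norm k))\<^sup>2 * norm k)"
proof -
  obtain c where c: "\<And>r. (f r)\<^sup>2 * \<bar>r\<bar> * (1 + r\<^sup>2) ^ 3 \<le> c"
    using schwartz_decay[OF assms] by blast
  have [measurable]: "f \<in> borel_measurable borel"
    by (rule schwartz_measurable[OF assms])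
  have "integrable lborel (\<lambda>k::real^3. c * (\<Prod>b\<in>Basis. inverse (1 + (k \<bullet> b)\<^sup>2)))"
    by (intro integrable_mult_right integrable_prod_inverse_1_plus_square)
  then show ?thesis
  proof (rule Bochner_Integration.integrable_bound)
    show "AE k::real^3 in lborel. norm ((f (norm k))\<^sup>2 * norm k)
        \<le> norm (c * (\<Prod>b\<in>Basis. inverse (1 + (k \<bullet> b)\<^sup>2)))"
    proof (intro AE_I2)
      fix k :: "real^3"
      let ?P = "\<Prod>b\<in>(Basis::(real^3) set). 1 + (k \<bullet> b)\<^sup>2"
      have P: "?P > 0"
        by (intro prod_pos) (auto simp: add_pos_nonneg)
      have "?P \<le> (\<Prod>b\<in>(Basis::(real^3) set). 1 + (norm k)\<^sup>2)"
        by (intro prod_mono) (auto simp: abs_le_square_iff[symmetric] Basis_le_norm)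
      then have "(f (norm k))\<^sup>2 * norm k * ?P \<le> (f (norm k))\<^sup>2 * norm k * (1 + (norm k)\<^sup>2) ^ 3"
        by (intro mult_left_mono) auto
      also have "\<dots> \<le> c"
        using c[of "norm k"] by simp
      finally have "(f (norm k))\<^sup>2 * norm k \<le> c / ?P"
        using P by (simp add: pos_le_divide_eq)
      also have "\<dots> = c * (\<Prod>b\<in>(Basis::(real^3) set). inverse (1 + (k \<bullet> b)\<^sup>2))"
        using prod_inversef[of "\<lambda>b. 1 + (k \<bullet> b)\<^sup>2" "Basis::(real^3) set"]
        by (simp add: divide_inverse comp_def)
      finally have "\<bar>(f (norm k))\<^sup>2 * norm k\<bar> \<le> \<bar>c * (\<Prod>b\<in>(Basis::(real^3) set). inverse (1 + (k \<bullet> b)\<^sup>2))\<bar>"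
        by (intro order_trans[OF _ abs_ge_self]) auto
      then show "norm ((f (norm k))\<^sup>2 * norm k) \<le> norm (c * (\<Prod>b\<in>Basis. inverse (1 + (k \<bullet> b)\<^sup>2)))"
        by simp
    qed
  qed measurable
qed

section \<open>Modes: integration over the momentum, summation over the component\<close>

lemma pair_sigma_finite_mode: "pair_sigma_finite (lborel :: (real^3) measure) (count_space (UNIV :: 3 set))"
  by (intro pair_sigma_finite.intro lborel.sigma_finite_measure_axioms
      sigma_finite_measure_count_space_finite) auto

lemma sigma_finite_mode_measure: "sigma_finite_measure mode_measure"
proof -
  interpret pair_sigma_finite "lborel :: (real^3) measure" "count_space (UNIV :: 3 set)"
    by (rule pair_sigma_finite_mode)
  show ?thesis
    unfolding mode_measure_def by (rule sigma_finite_measure_axioms)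
qed

lemma measurable_mode_measureI:
  assumes "\<And>j. (\<lambda>k. f (k, j)) \<in> borel_measurable borel"
  shows "f \<in> borel_measurable mode_measure"
proof -
  have "(\<lambda>q. f (fst q, snd q)) \<in> borel_measurable mode_measure"
    unfolding mode_measure_def
    by (rule measurable_compose_countable'[where f = "\<lambda>j q. f (fst q, j)" and g = snd and I = UNIV])
      (auto intro!: measurable_compose[OF measurable_fst] simp: assms)
  then show ?thesis
    by simp
qed

lemma integrable_modeI:
  fixes f :: "mode \<Rightarrow> 'b::{banach, second_countable_topology}"
  assumes "f \<in> borel_measurable mode_measure" "\<And>j. integrable lborel (\<lambda>k. f (k, j))"
  shows "integrable mode_measure f"
  unfolding mode_measure_def
  by (rule pair_sigma_finite.Fubini_integrable[OF pair_sigma_finite_mode])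
    (use assms in \<open>auto simp: mode_measure_def lebesgue_integral_count_space_finite
      integrable_count_space\<close>)

lemma
  fixes f :: "mode \<Rightarrow> 'b::{banach, second_countable_topology}"
  assumes "integrable mode_measure f"
  shows integral_mode: "(LINT q|mode_measure. f q) = (LINT k|lborel. (\<Sum>j\<in>UNIV. f (k, j)))"
    and integrable_mode_sum: "integrable lborel (\<lambda>k. \<Sum>j\<in>UNIV. f (k, j))"
  using pair_sigma_finite.integral_fst'[OF pair_sigma_finite_mode, of f]
    pair_sigma_finite.integrable_fst'[OF pair_sigma_finite_mode, of f] assms
  by (simp_all add: mode_measure_def lebesgue_integral_count_space_finite)

text \<open>Under this rotation about the third axis \<open>k \<wedge> e_2\<close> and \<open>k \<wedge> e_1\<close> are exchanged up to sign,
  which gives both \<open>C_11 = C_22\<close> and the vanishing of the integral for \<open>m \<noteq> n\<close>.\<close>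

definition quarter_turn :: "real^3 \<Rightarrow> real^3" where
  "quarter_turn k = vector [- (k $ 2), k $ 1, k $ 3]"

lemma quarter_turn_nth [simp]:
  "quarter_turn k $ 1 = - (k $ 2)" "quarter_turn k $ 2 = k $ 1" "quarter_turn k $ 3 = k $ 3"
  by (simp_all add: quarter_turn_def)

lemma norm_quarter_turn [simp]: "norm (quarter_turn k) = norm k"
  by (simp add: norm_vec_def L2_set_def sum_3 add.commute)

lemma measurable_quarter_turn [measurable]: "quarter_turn \<in> borel_measurable borel"
proof (intro borel_measurable_continuous_onI)
  have "quarter_turn = (\<lambda>k. (- (k $ 2)) *\<^sub>R axis 1 1 + (k $ 1) *\<^sub>R axis 2 1 + (k $ 3) *\<^sub>R axis 3 1)"
    by (simp add: fun_eq_iff vec_eq_iff forall_3 axis_def)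
  moreover have "continuous_on UNIV (\<lambda>k::real^3. (- (k $ 2)) *\<^sub>R axis 1 1 + (k $ 1) *\<^sub>R axis 2 1
      + (k $ 3) *\<^sub>R axis 3 1 :: real^3)"
    by (intro continuous_intros)
  ultimately show "continuous_on UNIV quarter_turn"
    by (simp only:)
qed

lemma prod_Basis_3:
  "(\<Prod>b\<in>(Basis::(real^3) set). f b) = f (axis 1 1) * f (axis 2 1) * f (axis 3 1)"
proof -
  have B: "(Basis::(real^3) set) = (\<lambda>i. axis i 1) ` UNIV"
    by (auto simp: Basis_vec_def)
  have "inj (\<lambda>i::3. axis i (1::real))"
    by (auto simp: inj_def axis_eq_axis)
  then have "prod f Basis = (\<Prod>i\<in>UNIV. f (axis i 1))"
    unfolding B by (simp add: prod.reindex)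
  also have "\<dots> = f (axis 1 1) * f (axis 2 1) * f (axis 3 1)"
    unfolding UNIV_3 by (simp add: mult.assoc)
  finally show ?thesis .
qed

text \<open>Lebesgue measure is determined by its values on boxes. The preimage of a box is again a
  box with two side lengths exchanged; the sign change swaps the end points in the second
  coordinate.\<close>

lemma lborel_distr_quarter_turn: "distr lborel borel quarter_turn = (lborel :: (real^3) measure)"
proof (rule lborel_eqI[symmetric])
  fix l u :: "real^3"
  assume le: "\<And>b. b \<in> Basis \<Longrightarrow> l \<bullet> b \<le> u \<bullet> b"
  have le': "l $ i \<le> u $ i" for i
    using le[of "axis i 1"] by (simp add: inner_axis)
  let ?l = "vector [l $ 2, - (u $ 1), l $ 3] :: real^3"
  let ?u = "vector [u $ 2, - (l $ 1), u $ 3] :: real^3"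
  have "quarter_turn -` box l u = box ?l ?u"
    by (auto simp: mem_box_cart forall_3)
  then have "emeasure (distr lborel borel quarter_turn) (box l u) = emeasure lborel (box ?l ?u)"
    by (simp add: emeasure_distr)
  also have "\<dots> = ennreal (\<Prod>b\<in>Basis. (?u - ?l) \<bullet> b)"
  proof (rule emeasure_lborel_box)
    fix b :: "real^3" assume "b \<in> Basis"
    then obtain i where "b = axis i 1" by (auto simp: Basis_vec_def)
    then show "?l \<bullet> b \<le> ?u \<bullet> b"
      using le' exhaust_3[of i] by (auto simp: inner_axis)
  qed
  also have "(\<Prod>b\<in>Basis. (?u - ?l) \<bullet> b) = (\<Prod>b\<in>Basis. (u - l) \<bullet> b)"
    by (simp add: prod_Basis_3 inner_axis)
  finally show "emeasure (distr lborel borel quarter_turn) (box l u) = ennreal (\<Prod>b\<in>Basis. (u - l) \<bullet> b)" .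
qed simp

lemma integral_quarter_turn:
  fixes f :: "real^3 \<Rightarrow> 'b::{banach, second_countable_topology}"
  assumes [measurable]: "f \<in> borel_measurable borel"
  shows "(LINT k|lborel. f (quarter_turn k)) = (LINT k|lborel. f k)"
proof -
  have "(LINT k|lborel. f k) = (LINT k|distr lborel borel quarter_turn. f k)"
    by (simp only: lborel_distr_quarter_turn)
  also have "\<dots> = (LINT k|lborel. f (quarter_turn k))"
    by (rule integral_distr) auto
  finally show ?thesis by simp
qed

text \<open>Reflection preserves Lebesgue measure, so the integral equals its own negative.\<close>

lemma integral_lborel_odd:
  fixes f :: "'a::euclidean_space \<Rightarrow> 'b::{banach, second_countable_topology}"
  assumes [measurable]: "f \<in> borel_measurable borel" and odd: "\<And>k. f (- k) = - f k"
  shows "(LINT k|lborel. f k) = 0"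
proof -
  have "(lborel :: 'a measure) = distr lborel borel uminus"
    using lborel_affine[of "-1" "0::'a"] by (simp add: density_1)
  then have "(LINT k|lborel. f k) = (LINT k|distr lborel borel uminus. f k)"
    by simp
  also have "\<dots> = (LINT k|lborel. f (- k))"
    by (rule integral_distr) auto
  also have "\<dots> = - (LINT k|lborel. f k)"
    by (simp add: odd)
  finally have "2 *\<^sub>R (LINT k|lborel. f k) = 0"
    by (metis add.right_inverse scaleR_2)
  then show ?thesis by simp
qed


section \<open>The resolvent\<close>

lemma pauli_3: "pauli 3 $ i $ j = (if i = j then if i = 1 then 1 else - 1 else 0)"
  using exhaust_2[of i] exhaust_2[of j] by (auto simp: pauli_def)

lemma spin_op_3: "spin_op l 3 a s = (if s l = 1 then a s else - a s)"
proof -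
  have "spin_op l 3 a s = (\<Sum>t\<in>UNIV. if s l = t then (if s l = 1 then 1 else - 1) * a (s(l := t)) else 0)"
    unfolding spin_op_def pauli_3 by (intro sum.cong) auto
  then show ?thesis
    by (simp add: sum.delta)
qed

lemma cnj_pauli: "cnj (pauli m $ i $ j) = pauli m $ j $ i"
  using exhaust_2[of i] exhaust_2[of j] by (auto simp: pauli_def)

lemma spin_op_hermitian: "spin_inner (spin_op l m a) b = spin_inner a (spin_op l m b)"
proof -
  \<comment> \<open>Exchanging the spin at \<open>l\<close> with the summation index is an
    involution on pairs. It carries one double sum to the other, once conjugation has transposed the
    Pauli entry.\<close>
  let ?i = "\<lambda>(s, t). (s(l := t), s l)"
  have "spin_inner (spin_op l m a) b
      = (\<Sum>(s, t)\<in>UNIV \<times> UNIV. pauli m $ t $ s l * cnj (a (s(l := t))) * b s)"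
    unfolding spin_inner_def spin_op_def
    by (simp add: cnj_pauli sum_distrib_right sum.cartesian_product)
  also have "\<dots> = (\<Sum>(s, t)\<in>UNIV \<times> UNIV. cnj (a s) * (pauli m $ s l $ t * b (s(l := t))))"
    by (rule sum.reindex_bij_witness[where i = ?i and j = ?i]) auto
  also have "\<dots> = spin_inner a (spin_op l m b)"
    unfolding spin_inner_def spin_op_def
    by (simp add: sum_distrib_left sum.cartesian_product)
  finally show ?thesis .
qed

definition spin_gap :: "real^3 \<Rightarrow> ('n::finite \<Rightarrow> 2) \<Rightarrow> real" where
  "spin_gap \<beta> s = 2 * norm \<beta> * real (card {l. s l = 1})"

lemma spin_gap_nonneg [simp]: "spin_gap \<beta> s \<ge> 0"
  by (simp add: spin_gap_def)

lemma zeeman_diagonal: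
  fixes s :: "'n::finite \<Rightarrow> 2"
  assumes "\<beta> = vector [0, 0, norm \<beta>]"
  shows "zeeman \<beta> a s = of_real (spin_gap \<beta> s - real CARD('n) * norm \<beta>) * a s"
proof -
  have \<beta>: "\<beta> $ 1 = 0" "\<beta> $ 2 = 0" "\<beta> $ 3 = norm \<beta>"
    by (subst assms, simp)+
  \<comment> \<open>The sign of a spin is written as twice the indicator of "up" minus 1, so that
    the sum over the sites splits into the gap and the ground level.\<close>
  have "zeeman \<beta> a s = (\<Sum>l\<in>UNIV. of_real (norm \<beta>) * (2 * of_bool (s l = 1) - 1) * a s)"
    unfolding zeeman_def by (intro sum.cong) (auto simp: sum_3 \<beta> spin_op_3)
  also have "\<dots> = of_real (spin_gap \<beta> s - real CARD('n) * norm \<beta>) * a s"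
    by (simp add: spin_gap_def sum_subtractf sum_of_bool_eq algebra_simps
        flip: sum_distrib_left sum_distrib_right)
  finally show ?thesis .
qed

section \<open>The shifted operator as a multiplier on the sectors\<close>

definition sector_energy :: "nat \<Rightarrow> (nat \<Rightarrow> mode) \<Rightarrow> real" where
  "sector_energy m p = (\<Sum>i<m. norm (fst (p i)))"

text \<open>This is an identity of representatives at every point; null sets enter only when the
  multiplier is inverted.\<close>

lemma K1_shift_eq_mult:
  fixes \<Psi> :: "'n::finite state"
  assumes "\<beta> = vector [0, 0, norm \<beta>]"
  shows "K1_shift \<beta> (- real CARD('n) * norm \<beta>) \<Psi> s m p
    = of_real (sector_energy m p + spin_gap \<beta> s) * \<Psi> s m p"
  by (simp add: K1_shift_def K1_def tensor_op_def second_quant_def mult_abs_def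
      zeeman_diagonal[OF assms] sector_energy_def algebra_simps sum_distrib_left)

lemma sector_energy_nonneg [simp]: "sector_energy m p \<ge> 0"
  by (simp add: sector_energy_def sum_nonneg)

lemma sector_energy_Suc_0 [simp]: "sector_energy (Suc 0) p = norm (fst (p 0))"
  by (simp add: sector_energy_def)

lemma sector_energy_ge:
  assumes "m > 0" "\<not> (\<exists>i<m. norm (fst (p i)) \<le> \<rho>)"
  shows "sector_energy m p \<ge> \<rho>"
proof -
  have "\<rho> \<le> norm (fst (p 0))"
    using assms by force
  also have "\<dots> \<le> sector_energy m p"
    unfolding sector_energy_def using assms(1) by (intro member_le_sum) auto
  finally show ?thesis .
qed

lemma sector_energy_permute:
  assumes "\<pi> permutes {..<m}"
  shows "sector_energy m (p \<circ> \<pi>) = sector_energy m p"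
  unfolding sector_energy_def comp_def
  using sum.permute[OF assms, of "\<lambda>i. norm (fst (p i))"] by (simp add: comp_def)

lemma sector_energy_upd: "sector_energy m (p(i := (fst (p i), j))) = sector_energy m p"
  unfolding sector_energy_def by (intro sum.cong) auto

lemma measurable_fst_mode_measure [measurable]: "fst \<in> borel_measurable mode_measure"
  unfolding mode_measure_def by (intro measurable_compose[OF measurable_fst]) simp

lemma measurable_sector_measure_component:
  "i < m \<Longrightarrow> (\<lambda>p. p i) \<in> measurable (sector_measure m) mode_measure"
  unfolding sector_measure_def by (rule measurable_component_singleton) simp

lemma measurable_sector_energy [measurable]: "sector_energy m \<in> borel_measurable (sector_measure m)"
  unfolding sector_energy_def
  by (intro borel_measurable_sum measurable_compose[OF measurable_sector_measure_component]) auto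

text \<open>The divisor depends only on the moduli of the momenta: it is invariant under
  permutations, does not see the component indices, and is at least \<open>\<rho>\<close> where
  \<open>f\<close> is non-zero. Sector 0 has no momenta and the divisor is zero there when
  \<open>c = 0\<close>, hence the last assumption.\<close>

lemma fock_sector_cut_divide:
  assumes f: "f \<in> fock_sector_cut \<rho> m" and \<rho>: "\<rho> > 0" and c: "c \<ge> 0"
    and 0: "m = 0 \<Longrightarrow> AE p in sector_measure m. f p = 0"
  shows "(\<lambda>p. f p / of_real (sector_energy m p + c)) \<in> fock_sector_cut \<rho> m"
proof -
  let ?M = "sector_measure m" and ?e = "\<lambda>p. sector_energy m p + c"
  note fD = f[unfolded fock_sector_cut_def fock_sector_def, simplified]
  have f_meas [measurable]: "f \<in> borel_measurable ?M"
    using fD by blast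
  have cut: "AE p in ?M. (\<exists>i<m. norm (fst (p i)) \<le> \<rho>) \<longrightarrow> f p = 0"
    using fD by blast
  have "integrable ?M (\<lambda>p. (norm (f p))\<^sup>2 / \<rho>\<^sup>2)"
    using fD by simp
  then have int: "integrable ?M (\<lambda>p. (norm (f p / of_real (?e p)))\<^sup>2)"
  proof (rule Bochner_Integration.integrable_bound)
    have "AE p in ?M. f p = 0 \<or> ?e p \<ge> \<rho>"
    proof (cases "m = 0")
      case True
      then show ?thesis using 0 by auto
    next
      case False
      show ?thesis
        using cut
      proof eventually_elim
        case (elim p)
        show ?case
          using elim False sector_energy_ge[of m p \<rho>] c by fastforce
      qed
    qed
    then show "AE p in ?M. norm ((norm (f p / of_real (?e p)))\<^sup>2) \<le> norm ((norm (f p))\<^sup>2 / \<rho>\<^sup>2)"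
    proof eventually_elim
      case (elim p)
      show ?case
      proof (cases "f p = 0")
        case False
        then have "\<rho> \<le> \<bar>?e p\<bar>"
          using elim by linarith
        then have "norm (f p) / \<bar>?e p\<bar> \<le> norm (f p) / \<rho>"
          using \<rho> by (intro divide_left_mono mult_pos_pos) auto
        then have "(norm (f p) / \<bar>?e p\<bar>)\<^sup>2 \<le> (norm (f p) / \<rho>)\<^sup>2"
          by (intro power_mono) auto
        then show ?thesis
          by (simp add: norm_divide power_divide del: of_real_add)
      qed simp
    qed
  qed measurable
  have sym: "AE p in ?M. f (p \<circ> \<pi>) / of_real (?e (p \<circ> \<pi>)) = f p / of_real (?e p)"
    if "\<pi> permutes {..<m}" for \<pi>
  proof -
    have "AE p in ?M. f (p \<circ> \<pi>) = f p"
      using fD that by blast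
    then show ?thesis
      by eventually_elim (simp add: sector_energy_permute[OF that])
  qed
  have trans: "AE p in ?M. (\<Sum>j\<in>UNIV. of_real (fst (p i) $ j) *
      (f (p(i := (fst (p i), j))) / of_real (?e (p(i := (fst (p i), j)))))) = 0" if "i < m" for i
  proof -
    have "AE p in ?M. (\<Sum>j\<in>UNIV. of_real (fst (p i) $ j) * f (p(i := (fst (p i), j)))) = 0"
      using fD that by blast
    then show ?thesis
    proof eventually_elim
      case (elim p)
      have "(\<Sum>j\<in>UNIV. of_real (fst (p i) $ j) *
          (f (p(i := (fst (p i), j))) / of_real (?e (p(i := (fst (p i), j))))))
        = (\<Sum>j\<in>UNIV. of_real (fst (p i) $ j) * f (p(i := (fst (p i), j)))) / of_real (?e p)"
        by (simp only: sector_energy_upd sum_divide_distrib times_divide_eq_right)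
      then show ?case
        by (simp only: elim) simp
    qed
  qed
  have "AE p in ?M. (\<exists>i<m. norm (fst (p i)) \<le> \<rho>) \<longrightarrow> f p / of_real (?e p) = 0"
    using cut by eventually_elim simp
  moreover have "(\<lambda>p. f p / of_real (?e p)) \<in> borel_measurable ?M"
    by measurable
  ultimately show ?thesis
    unfolding fock_sector_cut_def fock_sector_def using int sym trans by blast
qed

lemma odd_statesD:
  assumes "\<Psi> \<in> odd_states \<rho>"
  shows "\<Psi> s m \<in> fock_sector_cut \<rho> m" "\<Psi> s m \<in> borel_measurable (sector_measure m)"
    and "even m \<Longrightarrow> AE p in sector_measure m. \<Psi> s m p = 0"
    and "AE p in sector_measure m. (\<exists>i<m. norm (fst (p i)) \<le> \<rho>) \<longrightarrow> \<Psi> s m p = 0"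
  using assms by (auto simp: odd_states_def fock_odd_def fock_sector_cut_def fock_sector_def)

text \<open>The energy vanishes only where a cut vector is zero almost everywhere,
  so the value \<open>0\<close> of a division by zero is the right one here.\<close>

definition divide_energy :: "real^3 \<Rightarrow> 'n::finite state \<Rightarrow> 'n state" where
  "divide_energy \<beta> f = (\<lambda>s m p. f s m p / of_real (sector_energy m p + spin_gap \<beta> s))"

lemma divide_energy_odd_states:
  assumes f: "f \<in> odd_states \<rho>" and \<rho>: "\<rho> > 0"
  shows "divide_energy \<beta> f \<in> odd_states \<rho>"
proof -
  have "divide_energy \<beta> f s m \<in> fock_sector_cut \<rho> m" for s m
    unfolding divide_energy_def
    using odd_statesD[OF f] by (intro fock_sector_cut_divide[OF _ \<rho>]) auto
  moreover have "AE p in sector_measure m. divide_energy \<beta> f s m p = 0"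
    if "AE p in sector_measure m. f s m p = 0" for s m
    using that by eventually_elim (simp add: divide_energy_def)
  moreover have "\<exists>n. \<forall>m>n. AE p in sector_measure m. f s m p = 0" for s
    using f by (auto simp: odd_states_def fock_odd_def)
  ultimately show ?thesis
    using odd_statesD(3)[OF f] unfolding odd_states_def fock_odd_def mem_Collect_eq by metis
qed

lemma K1_shift_divide_energy:
  fixes f :: "'n::finite state"
  assumes \<beta>: "\<beta> = vector [0, 0, norm \<beta>]" and f: "f \<in> odd_states \<rho>" and \<rho>: "\<rho> > 0"
  shows "state_eq (K1_shift \<beta> (- real CARD('n) * norm \<beta>) (divide_energy \<beta> f)) f"
  unfolding state_eq_def
proof (intro allI)
  fix s m
  have "AE p in sector_measure m. (m = 0 \<longrightarrow> f s m p = 0) \<and>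
      ((\<exists>i<m. norm (fst (p i)) \<le> \<rho>) \<longrightarrow> f s m p = 0)"
    using odd_statesD(3)[OF f, of m s] odd_statesD(4)[OF f, of m s] by (cases "m = 0") auto
  then show "AE p in sector_measure m.
      K1_shift \<beta> (- real CARD('n) * norm \<beta>) (divide_energy \<beta> f) s m p = f s m p"
  proof eventually_elim
    case (elim p)
    have "f s m p = 0 \<or> sector_energy m p \<ge> \<rho>"
      using elim sector_energy_ge[of m p \<rho>] by blast
    then have "f s m p = 0 \<or> sector_energy m p + spin_gap \<beta> s \<noteq> 0"
      using \<rho> spin_gap_nonneg[of \<beta> s] by linarith
    then show ?case
      unfolding K1_shift_eq_mult[OF \<beta>] divide_energy_def
      by (auto simp del: of_real_add)
  qed
qed

text \<open>Almost everywhere, a non-zero value of \<open>v\<close> forces the multiplier to be at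
  least \<open>\<rho>\<close>, so it can be divided out. Where \<open>v\<close> vanishes, the
  equation makes \<open>f\<close> vanish too, and the quotient is again 0.\<close>

lemma K1_shift_unique:
  fixes f v :: "'n::finite state"
  assumes \<beta>: "\<beta> = vector [0, 0, norm \<beta>]" and \<rho>: "\<rho> > 0" and v: "v \<in> odd_states \<rho>"
    and eq: "state_eq (K1_shift \<beta> (- real CARD('n) * norm \<beta>) v) f"
  shows "state_eq v (divide_energy \<beta> f)"
  unfolding state_eq_def
proof (intro allI)
  fix s m
  have "AE p in sector_measure m. (m = 0 \<longrightarrow> v s m p = 0) \<and>
      ((\<exists>i<m. norm (fst (p i)) \<le> \<rho>) \<longrightarrow> v s m p = 0)"
    using odd_statesD(3)[OF v, of m s] odd_statesD(4)[OF v, of m s] by (cases "m = 0") auto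
  moreover have "AE p in sector_measure m.
      of_real (sector_energy m p + spin_gap \<beta> s) * v s m p = f s m p"
    using eq unfolding state_eq_def K1_shift_eq_mult[OF \<beta>] by blast
  ultimately show "AE p in sector_measure m. v s m p = divide_energy \<beta> f s m p"
  proof eventually_elim
    case (elim p)
    have "v s m p = 0 \<or> sector_energy m p \<ge> \<rho>"
      using elim sector_energy_ge[of m p \<rho>] by blast
    then have "v s m p = 0 \<or> sector_energy m p + spin_gap \<beta> s \<noteq> 0"
      using \<rho> spin_gap_nonneg[of \<beta> s] by linarith
    then show ?case
      using elim unfolding divide_energy_def
      by (auto simp: nonzero_eq_divide_eq mult.commute simp del: of_real_add)
  qed
qed

text \<open>The explicit quotient shows that the choice in \<open>resolvent\<close> has a witness.
  Uniqueness then pins down the chosen vector up to null sets, which is all that inner products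
  see.\<close>

lemma
  fixes f :: "'n::finite state"
  assumes \<beta>: "\<beta> = vector [0, 0, norm \<beta>]" and f: "f \<in> odd_states \<rho>" and \<rho>: "\<rho> > 0"
    and z: "z = - real CARD('n) * norm \<beta>"
  shows resolvent_odd_states: "resolvent \<rho> \<beta> z f \<in> odd_states \<rho>"
    and K1_shift_resolvent: "state_eq (K1_shift \<beta> z (resolvent \<rho> \<beta> z f)) f"
    and resolvent_eq_divide_energy: "state_eq (resolvent \<rho> \<beta> z f) (divide_energy \<beta> f)"
proof -
  have "resolvent \<rho> \<beta> z f \<in> odd_states \<rho> \<and> state_eq (K1_shift \<beta> z (resolvent \<rho> \<beta> z f)) f"
    unfolding resolvent_def z
    by (rule someI[of _ "divide_energy \<beta> f"])
      (intro conjI divide_energy_odd_states[OF f \<rho>] K1_shift_divide_energy[OF \<beta> f \<rho>])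
  then show "resolvent \<rho> \<beta> z f \<in> odd_states \<rho>" "state_eq (K1_shift \<beta> z (resolvent \<rho> \<beta> z f)) f"
    "state_eq (resolvent \<rho> \<beta> z f) (divide_energy \<beta> f)"
    using K1_shift_unique[OF \<beta> \<rho>] z by auto
qed

lemma uminus_odd_states:
  assumes "\<Psi> \<in> odd_states \<rho>"
  shows "(\<lambda>s m p. - \<Psi> s m p) \<in> odd_states \<rho>"
  using assms
  by (simp add: odd_states_def fock_odd_def fock_sector_cut_def fock_sector_def sum_negf)


section \<open>One-particle states\<close>

lemma borel_measurable_cnj [measurable (raw)]:
  "f \<in> borel_measurable M \<Longrightarrow> (\<lambda>x. cnj (f x)) \<in> borel_measurable M"
  by (rule measurable_compose[OF _ borel_measurable_continuous_onI]) (auto intro: continuous_intros)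

section \<open>The one-particle sector as the space of modes\<close>

lemma product_sigma_finite_mode_measure: "product_sigma_finite (\<lambda>_::nat. mode_measure)"
  using sigma_finite_mode_measure by (simp add: product_sigma_finite_def)

lemma lessThan_1_eq: "{..<1::nat} = {0}"
  by auto

lemma distr_sector_measure_1: "distr (sector_measure 1) mode_measure (\<lambda>p. p 0) = mode_measure"
  unfolding sector_measure_def lessThan_1_eq
  using product_sigma_finite.distr_singleton[OF product_sigma_finite_mode_measure, of 0]
  by simp

lemma measurable_sector_1_component [measurable]: "(\<lambda>p. p 0) \<in> measurable (sector_measure 1) mode_measure"
  by (rule measurable_sector_measure_component) simp

lemma integral_sector_1:
  fixes f :: "mode \<Rightarrow> 'b::{banach, second_countable_topology}"
  assumes "f \<in> borel_measurable mode_measure"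
  shows "(LINT p|sector_measure 1. f (p 0)) = (LINT q|mode_measure. f q)"
proof -
  have "(LINT q|distr (sector_measure 1) mode_measure (\<lambda>p. p 0). f q) = (LINT p|sector_measure 1. f (p 0))"
    using assms by (intro integral_distr) measurable
  then show ?thesis
    by (simp only: distr_sector_measure_1)
qed

lemma integrable_sector_1:
  fixes f :: "mode \<Rightarrow> 'b::{banach, second_countable_topology}"
  assumes "integrable mode_measure f"
  shows "integrable (sector_measure 1) (\<lambda>p. f (p 0))"
proof -
  have "integrable (distr (sector_measure 1) mode_measure (\<lambda>p. p 0)) f"
    using assms by (simp only: distr_sector_measure_1)
  then show ?thesis
    by (rule integrable_distr[rotated]) measurable
qed

lemma space_mode_measure [simp]: "space mode_measure = UNIV"
  by (simp add: mode_measure_def space_pair_measure)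

text \<open>The only point of the empty product is \<open>\<lambda>_. undefined\<close>, so
  annihilation into sector 0 evaluates a vector at these sequences. They are exactly the points of
  the product over one index, since such points are \<open>undefined\<close> outside it.\<close>

lemma measurable_case_nat_undefined:
  "(\<lambda>q. case_nat q (\<lambda>_. undefined)) \<in> measurable mode_measure (sector_measure 1)"
proof -
  have "(\<lambda>q. case_nat q (\<lambda>_. undefined)) = (\<lambda>q. \<lambda>i\<in>{..<1::nat}. q :: mode)"
    by (auto simp: fun_eq_iff restrict_def split: nat.split)
  moreover have "(\<lambda>q. \<lambda>i\<in>{..<1::nat}. q) \<in> measurable mode_measure (sector_measure 1)"
    unfolding sector_measure_def by (intro measurable_restrict) auto
  ultimately show ?thesis by (simp only:)
qed

lemma case_nat_sector_1:
  "p \<in> space (sector_measure 1) \<Longrightarrow> case_nat (p 0) (\<lambda>_. undefined) = p"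
  by (auto simp: sector_measure_def space_PiM PiE_def extensional_def fun_eq_iff split: nat.split)

definition one_particle :: "(('n \<Rightarrow> 2) \<Rightarrow> mode \<Rightarrow> complex) \<Rightarrow> 'n state" where
  "one_particle g = (\<lambda>s m p. if m = 1 then g s (p 0) else 0)"

text \<open>Transversality and the cutoff are demanded at every point rather than almost everywhere.
  The explicit couplings satisfy this, and sums and quotients then inherit it without null
  sets.\<close>

definition cut_modes :: "real \<Rightarrow> (mode \<Rightarrow> complex) set" where
  "cut_modes \<rho> = {g \<in> borel_measurable mode_measure. integrable mode_measure (\<lambda>q. (norm (g q))\<^sup>2)
     \<and> (\<forall>k. (\<Sum>j\<in>UNIV. of_real (k $ j) * g (k, j)) = 0) \<and> (\<forall>q. norm (fst q) \<le> \<rho> \<longrightarrow> g q = 0)}"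

lemma cut_modesD:
  assumes "g \<in> cut_modes \<rho>"
  shows "g \<in> borel_measurable mode_measure" "integrable mode_measure (\<lambda>q. (norm (g q))\<^sup>2)"
    and "(\<Sum>j\<in>UNIV. of_real (k $ j) * g (k, j)) = 0"
    and "norm (fst q) \<le> \<rho> \<Longrightarrow> g q = 0"
  using assms unfolding cut_modes_def by blast+

lemma zero_cut_modes: "(\<lambda>q. 0) \<in> cut_modes \<rho>"
  by (simp add: cut_modes_def)

lemma add_cut_modes:
  assumes f: "f \<in> cut_modes \<rho>" and g: "g \<in> cut_modes \<rho>"
  shows "(\<lambda>q. f q + g q) \<in> cut_modes \<rho>"
proof -
  have [measurable]: "f \<in> borel_measurable mode_measure" "g \<in> borel_measurable mode_measure"
    using f g by (auto dest: cut_modesD)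
  have "integrable mode_measure (\<lambda>q. 2 * ((norm (f q))\<^sup>2 + (norm (g q))\<^sup>2))"
    using cut_modesD(2)[OF f] cut_modesD(2)[OF g] by simp
  then have "integrable mode_measure (\<lambda>q. (norm (f q + g q))\<^sup>2)"
  proof (rule Bochner_Integration.integrable_bound)
    have "(norm (f q + g q))\<^sup>2 \<le> 2 * ((norm (f q))\<^sup>2 + (norm (g q))\<^sup>2)" for q
    proof -
      have "(norm (f q + g q))\<^sup>2 \<le> (norm (f q) + norm (g q))\<^sup>2"
        by (intro power_mono norm_triangle_ineq) simp
      also have "\<dots> \<le> 2 * ((norm (f q))\<^sup>2 + (norm (g q))\<^sup>2)"
        using sum_squares_bound[of "norm (f q)" "norm (g q)"] by (simp add: power2_sum)
      finally show ?thesis .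
    qed
    then show "AE q in mode_measure. norm ((norm (f q + g q))\<^sup>2) \<le> norm (2 * ((norm (f q))\<^sup>2 + (norm (g q))\<^sup>2))"
      by simp
  qed measurable
  then show ?thesis
    using cut_modesD(3,4)[OF f] cut_modesD(3,4)[OF g]
    by (simp add: cut_modes_def distrib_left sum.distrib)
qed

lemma cmult_cut_modes:
  assumes "g \<in> cut_modes \<rho>"
  shows "(\<lambda>q. c * g q) \<in> cut_modes \<rho>"
proof -
  have "(\<Sum>j\<in>UNIV. of_real (k $ j) * (c * g (k, j))) = c * (\<Sum>j\<in>UNIV. of_real (k $ j) * g (k, j))" for k
    by (simp add: sum_distrib_left mult.left_commute)
  moreover have [measurable]: "g \<in> borel_measurable mode_measure"
    using assms by (rule cut_modesD)
  ultimately show ?thesis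
    using assms by (simp add: cut_modes_def norm_mult power_mult_distrib)
qed

lemma sum_cut_modes:
  assumes "\<And>i. i \<in> A \<Longrightarrow> g i \<in> cut_modes \<rho>"
  shows "(\<lambda>q. \<Sum>i\<in>A. g i q) \<in> cut_modes \<rho>"
  using assms by (induction A rule: infinite_finite_induct) (auto intro: zero_cut_modes add_cut_modes)

lemma integrable_cnj_mult:
  assumes f: "f \<in> cut_modes \<rho>" and g: "g \<in> cut_modes \<rho>'"
  shows "integrable mode_measure (\<lambda>q. cnj (f q) * g q)"
proof -
  have [measurable]: "f \<in> borel_measurable mode_measure" "g \<in> borel_measurable mode_measure"
    using f g by (auto dest: cut_modesD)
  have "integrable mode_measure (\<lambda>q. (norm (f q))\<^sup>2 + (norm (g q))\<^sup>2)"
    using f g by (auto dest: cut_modesD)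
  then show ?thesis
  proof (rule Bochner_Integration.integrable_bound)
    have "norm (f q) * norm (g q) \<le> (norm (f q))\<^sup>2 + (norm (g q))\<^sup>2" for q
      using sum_squares_bound[of "norm (f q)" "norm (g q)"]
        mult_nonneg_nonneg[OF norm_ge_zero norm_ge_zero, of "f q" "g q"] by linarith
    then show "AE q in mode_measure. norm (cnj (f q) * g q) \<le> norm ((norm (f q))\<^sup>2 + (norm (g q))\<^sup>2)"
      by (simp add: norm_mult)
  qed measurable
qed

lemma divide_energy_cut_modes:
  assumes g: "g \<in> cut_modes \<rho>" and \<rho>: "\<rho> > 0" and c: "c \<ge> 0"
  shows "(\<lambda>q. g q / of_real (norm (fst q) + c)) \<in> cut_modes \<rho>"
proof -
  have [measurable]: "g \<in> borel_measurable mode_measure"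
    using g by (auto dest: cut_modesD)
  have "integrable mode_measure (\<lambda>q. (norm (g q))\<^sup>2 / \<rho>\<^sup>2)"
    using g by (auto dest: cut_modesD)
  then have "integrable mode_measure (\<lambda>q. (norm (g q / of_real (norm (fst q) + c)))\<^sup>2)"
  proof (rule Bochner_Integration.integrable_bound)
    have "(norm (g q / of_real (norm (fst q) + c)))\<^sup>2 \<le> (norm (g q))\<^sup>2 / \<rho>\<^sup>2" for q
    proof (cases "norm (fst q) \<le> \<rho>")
      case False
      then have "norm (g q) / \<bar>norm (fst q) + c\<bar> \<le> norm (g q) / \<rho>"
        using \<rho> c by (intro divide_left_mono mult_pos_pos) auto
      then have "(norm (g q) / \<bar>norm (fst q) + c\<bar>)\<^sup>2 \<le> (norm (g q) / \<rho>)\<^sup>2"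
        by (intro power_mono) auto
      then show ?thesis
        by (simp add: norm_divide power_divide del: of_real_add)
    qed (simp add: cut_modesD(4)[OF g])
    then show "AE q in mode_measure. norm ((norm (g q / of_real (norm (fst q) + c)))\<^sup>2)
        \<le> norm ((norm (g q))\<^sup>2 / \<rho>\<^sup>2)"
      by simp
  qed measurable
  moreover have "(\<Sum>j\<in>UNIV. of_real (k $ j) * (g (k, j) / of_real (norm (fst (k, j)) + c))) = 0" for k
    using cut_modesD(3)[OF g, of k] by (simp flip: sum_divide_distrib)
  ultimately show ?thesis
    using cut_modesD(4)[OF g] by (simp add: cut_modes_def)
qed

lemma one_particle_odd_states:
  assumes "\<And>s. g s \<in> cut_modes \<rho>"
  shows "one_particle g \<in> odd_states \<rho>"
proof -
  have one: "(\<lambda>p. g s (p 0)) \<in> fock_sector_cut \<rho> 1" for s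
  proof -
    have [measurable]: "g s \<in> borel_measurable mode_measure"
      using assms by (auto dest: cut_modesD)
    have "g s ((p \<circ> \<pi>) 0) = g s (p 0)" if "\<pi> permutes {..<1::nat}" for \<pi> p
      using that unfolding lessThan_1_eq by simp
    moreover have "(\<lambda>p. g s (p 0)) \<in> borel_measurable (sector_measure 1)"
      by measurable
    moreover have "(\<Sum>j\<in>UNIV. of_real (fst (p 0) $ j) * g s (fst (p 0), j)) = 0" for p
      by (rule cut_modesD(3)[OF assms])
    ultimately show ?thesis
      using integrable_sector_1[OF cut_modesD(2)[OF assms[of s]]] cut_modesD(4)[OF assms[of s]]
      unfolding fock_sector_cut_def fock_sector_def by (auto simp del: One_nat_def)
  qed
  have "one_particle g s m \<in> fock_sector_cut \<rho> m" for s m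
  proof (cases "m = 1")
    case True
    then show ?thesis
      using one[of s] by (simp add: one_particle_def)
  next
    case False
    then show ?thesis
      by (simp add: one_particle_def fock_sector_cut_def fock_sector_def)
  qed
  moreover have "\<forall>m. even m \<longrightarrow> (AE p in sector_measure m. one_particle g s m p = 0)" for s
    by (auto simp: one_particle_def)
  moreover have "\<forall>m>1. AE p in sector_measure m. one_particle g s m p = 0" for s
    by (auto simp: one_particle_def)
  ultimately show ?thesis
    unfolding odd_states_def fock_odd_def by blast
qed

lemma divide_energy_one_particle:
  "divide_energy \<beta> (one_particle g)
    = one_particle (\<lambda>s q. g s q / of_real (norm (fst q) + spin_gap \<beta> s))"
  by (auto simp: divide_energy_def one_particle_def fun_eq_iff)

text \<open>The second argument vanishes identically outside sector 1, so the series has one term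
  whatever \<open>\<Phi>\<close> does on null sets elsewhere; in sector 1 the integral sees
  \<open>\<Phi>\<close> only up to null sets.\<close>

lemma state_inner_one_particle:
  assumes \<Phi>: "\<Phi> \<in> odd_states \<rho>" and eq: "state_eq \<Phi> (one_particle g)"
    and g: "\<And>s. g s \<in> borel_measurable mode_measure"
    and h: "\<And>s. h s \<in> borel_measurable mode_measure"
  shows "state_inner \<Phi> (one_particle h) = (\<Sum>s\<in>UNIV. LINT q|mode_measure. cnj (g s q) * h s q)"
  unfolding state_inner_def
proof (intro sum.cong refl)
  fix s
  have [measurable]: "\<Phi> s 1 \<in> borel_measurable (sector_measure 1)"
    "g s \<in> borel_measurable mode_measure" "h s \<in> borel_measurable mode_measure"
    using odd_statesD(2)[OF \<Phi>] g h by auto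
  have "fock_inner (\<Phi> s) (one_particle h s)
      = (\<Sum>m\<in>{1}. LINT p|sector_measure m. cnj (\<Phi> s m p) * one_particle h s m p)"
    unfolding fock_inner_def by (rule suminf_finite) (auto simp: one_particle_def)
  also have "\<dots> = (LINT p|sector_measure 1. cnj (\<Phi> s 1 p) * h s (p 0))"
    by (simp add: one_particle_def)
  also have "\<dots> = (LINT p|sector_measure 1. cnj (g s (p 0)) * h s (p 0))"
  proof (rule integral_cong_AE)
    have "AE p in sector_measure 1. \<Phi> s 1 p = one_particle g s 1 p"
      using eq unfolding state_eq_def by blast
    then show "AE p in sector_measure 1. cnj (\<Phi> s 1 p) * h s (p 0) = cnj (g s (p 0)) * h s (p 0)"
      by eventually_elim (simp add: one_particle_def)
  qed measurable
  also have "\<dots> = (LINT q|mode_measure. cnj (g s q) * h s q)"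
    by (rule integral_sector_1) measurable
  finally show "fock_inner (\<Phi> s) (one_particle h s) = (LINT q|mode_measure. cnj (g s q) * h s q)" .
qed

lemma annihilation_one_particle:
  assumes \<Phi>: "\<Phi> \<in> odd_states \<rho>" and eq: "state_eq \<Phi> (one_particle g)"
    and g: "g s \<in> borel_measurable mode_measure" and f: "f \<in> borel_measurable mode_measure"
  shows "annihilation f (\<Phi> s) 0 (\<lambda>_. undefined) = (LINT q|mode_measure. cnj (f q) * g s q)"
proof -
  have \<Phi>s [measurable]: "\<Phi> s 1 \<in> borel_measurable (sector_measure 1)"
    using odd_statesD(2)[OF \<Phi>] .
  note [measurable] = g f
  have [measurable]: "(\<lambda>q. \<Phi> s 1 (case_nat q (\<lambda>_. undefined))) \<in> borel_measurable mode_measure"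
    by (rule measurable_compose[OF measurable_case_nat_undefined \<Phi>s])
  have "annihilation f (\<Phi> s) 0 (\<lambda>_. undefined)
      = (LINT q|mode_measure. cnj (f q) * \<Phi> s 1 (case_nat q (\<lambda>_. undefined)))"
    by (simp add: annihilation_def)
  \<comment> \<open>The integral is moved from modes to the sector because the almost-everywhere
    equality of \<open>\<Phi>\<close> with \<open>g\<close> is known for the sector measure.\<close>
  also have "\<dots> = (LINT p|sector_measure 1. cnj (f (p 0)) * \<Phi> s 1 (case_nat (p 0) (\<lambda>_. undefined)))"
    by (rule integral_sector_1[symmetric]) measurable
  also have "\<dots> = (LINT p|sector_measure 1. cnj (f (p 0)) * \<Phi> s 1 p)"
    by (intro Bochner_Integration.integral_cong) (simp_all add: case_nat_sector_1)
  also have "\<dots> = (LINT p|sector_measure 1. cnj (f (p 0)) * g s (p 0))"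
  proof (rule integral_cong_AE)
    have "AE p in sector_measure 1. \<Phi> s 1 p = one_particle g s 1 p"
      using eq unfolding state_eq_def by blast
    then show "AE p in sector_measure 1. cnj (f (p 0)) * \<Phi> s 1 p = cnj (f (p 0)) * g s (p 0)"
      by eventually_elim (simp add: one_particle_def)
  qed measurable
  also have "\<dots> = (LINT q|mode_measure. cnj (f q) * g s q)"
    by (rule integral_sector_1) measurable
  finally show ?thesis .
qed

text \<open>Sector 0 is a single point of mass 1, so pairing with the vacuum is evaluation at that
  point.\<close>

lemma state_inner_vacuum:
  "state_inner \<Psi> (tensor vacuum a) = spin_inner (\<lambda>s. \<Psi> s 0 (\<lambda>_. undefined)) a"
  unfolding state_inner_def spin_inner_def
proof (intro sum.cong refl)
  fix s
  have "fock_inner (\<Psi> s) (tensor vacuum a s)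
      = (\<Sum>m\<in>{0}. LINT p|sector_measure m. cnj (\<Psi> s m p) * tensor vacuum a s m p)"
    unfolding fock_inner_def by (rule suminf_finite) (auto simp: tensor_def vacuum_def)
  also have "\<dots> = cnj (\<Psi> s 0 (\<lambda>_. undefined)) * a s"
    by (simp add: tensor_def vacuum_def sector_measure_def PiM_empty lebesgue_integral_count_space_finite)
  finally show "fock_inner (\<Psi> s) (tensor vacuum a s) = cnj (\<Psi> s 0 (\<lambda>_. undefined)) * a s" .
qed

definition coupling :: "(real \<Rightarrow> real) \<Rightarrow> 3 \<Rightarrow> real^3 \<Rightarrow> mode \<Rightarrow> complex" where
  "coupling chi m y = complexify (field_a chi m y) (field_b chi m y)"

lemma tensor_field_vacuum:
  "tensor (field chi m y vacuum) a = one_particle (\<lambda>s q. of_real (1 / sqrt 2) * coupling chi m y q * a s)"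
  by (auto simp: tensor_def field_def segal_vacuum one_particle_def coupling_def fun_eq_iff)

lemma K32_tensor_vacuum:
  "K32 chi x (tensor vacuum a) = one_particle (\<lambda>s q. \<Sum>l\<in>UNIV. \<Sum>m\<in>UNIV.
     of_real (1 / sqrt 2) * coupling chi m (x l) q * spin_op l m a s)"
proof -
  \<comment> \<open>In \<open>K32\<close> the field acts on each spin coordinate separately, and
    there the spin amplitude appears as a scalar multiplying the vacuum.\<close>
  have smult: "segal f (\<lambda>m p. vacuum m p * c) n p = segal f vacuum n p * c" for f c n p
    by (simp add: segal_def annihilation_def creation_def algebra_simps sum_distrib_left vacuum_def)
  show ?thesis
    by (auto simp: K32_def tensor_op_def tensor_def field_def smult segal_vacuum one_particle_def
        coupling_def spin_op_def sum_distrib_left sum_divide_distrib mult_ac fun_eq_iff)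
qed

text \<open>Only the zero-particle part of \<open>K32 chi x \<Phi>\<close> meets the vacuum, and
  creation contributes nothing to it. The annihilation integral is the conjugate of the pairing with
  the created particle, and the Pauli matrices are Hermitian.\<close>

lemma state_inner_K32_vacuum:
  fixes x :: "'n::finite \<Rightarrow> real^3"
  assumes \<Phi>: "\<Phi> \<in> odd_states \<rho>" and eq: "state_eq \<Phi> (one_particle g)"
    and g: "\<And>s. g s \<in> cut_modes \<rho>" and cpl: "\<And>m l. coupling chi m (x l) \<in> cut_modes \<rho>"
  shows "state_inner (K32 chi x \<Phi>) (tensor vacuum a) = state_inner \<Phi> (K32 chi x (tensor vacuum a))"
proof -
  \<comment> \<open>\<open>G l m s\<close> is the vacuum amplitude left when the field at particle
    \<open>l\<close> absorbs the particle in spin coordinate \<open>s\<close>.\<close>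
  define G where "G l m s = of_real (1 / sqrt 2) * (LINT q|mode_measure. cnj (coupling chi m (x l) q) * g s q)"
    for l m s
  have field: "field chi m (x l) (\<Phi> s) 0 (\<lambda>_. undefined) = G l m s" for l m s
    unfolding G_def field_def segal_def coupling_def[symmetric]
    using annihilation_one_particle[OF \<Phi> eq cut_modesD(1)[OF g] cut_modesD(1)[OF cpl]]
    by (simp add: creation_def)
  have "state_inner (K32 chi x \<Phi>) (tensor vacuum a)
      = spin_inner (\<lambda>s. \<Sum>l\<in>UNIV. \<Sum>m\<in>UNIV. spin_op l m (G l m) s) a"
    unfolding state_inner_vacuum K32_def tensor_op_def by (simp add: field)
  also have "\<dots> = (\<Sum>l\<in>UNIV. \<Sum>m\<in>UNIV. spin_inner (spin_op l m (G l m)) a)"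
    unfolding spin_inner_def cnj_sum sum_distrib_right
    by (subst sum.swap, intro sum.cong refl, subst sum.swap) (rule refl)
  also have "\<dots> = (\<Sum>l\<in>UNIV. \<Sum>m\<in>UNIV. spin_inner (G l m) (spin_op l m a))"
    by (simp add: spin_op_hermitian)
  also have "\<dots> = (\<Sum>s\<in>UNIV. \<Sum>l\<in>UNIV. \<Sum>m\<in>UNIV. cnj (G l m s) * spin_op l m a s)"
    unfolding spin_inner_def
    by (subst (2) sum.swap, intro sum.cong refl) (rule sum.swap)
  also have "\<dots> = (\<Sum>s\<in>UNIV. LINT q|mode_measure. cnj (g s q) * (\<Sum>l\<in>UNIV. \<Sum>m\<in>UNIV.
     of_real (1 / sqrt 2) * coupling chi m (x l) q * spin_op l m a s))"
  proof (intro sum.cong refl)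
    fix s
    have cnj_G: "cnj (G l m s) = of_real (1 / sqrt 2) * (LINT q|mode_measure. cnj (g s q) * coupling chi m (x l) q)"
      for l m
    proof -
      have "cnj (LINT q|mode_measure. cnj (coupling chi m (x l) q) * g s q)
          = (LINT q|mode_measure. cnj (cnj (coupling chi m (x l) q) * g s q))"
        by (rule Bochner_Integration.integral_cnj[symmetric])
      also have "\<dots> = (LINT q|mode_measure. cnj (g s q) * coupling chi m (x l) q)"
        by (simp add: mult.commute)
      finally show ?thesis
        unfolding G_def by (simp only: complex_cnj_mult complex_cnj_complex_of_real)
    qed
    have int: "integrable mode_measure (\<lambda>q. cnj (g s q) * coupling chi m (x l) q)" for l m
      by (rule integrable_cnj_mult[OF g cpl])
    have "(\<Sum>l\<in>UNIV. \<Sum>m\<in>UNIV. cnj (G l m s) * spin_op l m a s)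
      = (\<Sum>l\<in>UNIV. \<Sum>m\<in>UNIV. (of_real (1 / sqrt 2) * spin_op l m a s) *
          (LINT q|mode_measure. cnj (g s q) * coupling chi m (x l) q))"
      by (simp only: cnj_G mult_ac)
    also have "\<dots> = (LINT q|mode_measure. (\<Sum>l\<in>UNIV. \<Sum>m\<in>UNIV. (of_real (1 / sqrt 2) * spin_op l m a s) *
          (cnj (g s q) * coupling chi m (x l) q)))"
      by (simp only: Bochner_Integration.integral_sum Bochner_Integration.integrable_sum
          integrable_mult_right int integral_mult_right_zero)
    also have "\<dots> = (LINT q|mode_measure. cnj (g s q) * (\<Sum>l\<in>UNIV. \<Sum>m\<in>UNIV.
     of_real (1 / sqrt 2) * coupling chi m (x l) q * spin_op l m a s))"
      by (simp add: sum_distrib_left mult_ac)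
    finally show "(\<Sum>l\<in>UNIV. \<Sum>m\<in>UNIV. cnj (G l m s) * spin_op l m a s)
      = (LINT q|mode_measure. cnj (g s q) * (\<Sum>l\<in>UNIV. \<Sum>m\<in>UNIV.
     of_real (1 / sqrt 2) * coupling chi m (x l) q * spin_op l m a s))" .
  qed
  also have "\<dots> = state_inner \<Phi> (K32 chi x (tensor vacuum a))"
    unfolding K32_tensor_vacuum
    by (intro state_inner_one_particle[OF \<Phi> eq, symmetric] borel_measurable_sum borel_measurable_times
        borel_measurable_const cut_modesD(1)[OF g] cut_modesD(1)[OF cpl])
  finally show ?thesis .
qed


section \<open>Couplings and flipped spins\<close>

lemma cross3_axis:
  "cross3 k (axis 1 1) = vector [0, k $ 3, - (k $ 2)]"
  "cross3 k (axis 2 1) = vector [- (k $ 3), 0, k $ 1]"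
  "cross3 k (axis 3 1) = vector [k $ 2, - (k $ 1), 0]"
  by (simp_all add: cross3_def axis_def)

lemma measurable_vec_nth [measurable]: "(\<lambda>k::real^3. k $ i) \<in> borel_measurable borel"
  by (intro borel_measurable_continuous_onI continuous_intros)

lemma measurable_cross3_axis_nth [measurable]:
  "(\<lambda>k. cross3 k (axis m 1) $ j) \<in> borel_measurable borel"
  using exhaust_3[of m] exhaust_3[of j] by (auto simp: cross3_axis)

lemma measurable_cross3_inner [measurable]:
  "(\<lambda>k. cross3 k (axis m 1) \<bullet> cross3 k (axis n 1)) \<in> borel_measurable borel"
  unfolding inner_vec_def by simp

lemma norm_cross3_axis_le: "norm (cross3 k (axis m 1)) \<le> norm k"
proof -
  have "(norm (cross3 k (axis m 1)))\<^sup>2 + (k \<bullet> axis m 1)\<^sup>2 = (norm k)\<^sup>2"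
    by (simp add: norm_cross_dot power_mult_distrib)
  then have "(norm (cross3 k (axis m 1)))\<^sup>2 \<le> (norm k)\<^sup>2"
    using zero_le_power2[of "k \<bullet> axis m 1"] by linarith
  then show ?thesis
    by (rule power2_le_imp_le) simp
qed

definition amplitude :: "(real \<Rightarrow> real) \<Rightarrow> real^3 \<Rightarrow> real" where
  "amplitude chi k = chi (norm k) * sqrt (norm k) / (2 * pi) powr (3/2)"

lemma amplitude_power2: "(amplitude chi k)\<^sup>2 = (chi (norm k))\<^sup>2 * norm k / (2 * pi) ^ 3"
proof -
  have "((2 * pi) powr (3/2))\<^sup>2 = (2 * pi) powr 3"
    by (simp add: power2_eq_square flip: powr_add)
  also have "\<dots> = (2 * pi) ^ 3"
    by (simp add: powr_numeral)
  finally show ?thesis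
    by (simp add: amplitude_def power_mult_distrib power_divide)
qed

text \<open>The last factor is sin + i cos = i exp(- i k . y), of modulus 1. Positions therefore
  drop out of norms and enter products of two couplings only through their difference.\<close>

lemma coupling_eq:
  "coupling chi m y (k, j) = of_real (amplitude chi k * (cross3 k (axis m 1) $ j / norm k)) *
     Complex (sin (k \<bullet> y)) (cos (k \<bullet> y))"
  by (simp add: coupling_def complexify_def field_a_def field_b_def amplitude_def
      complex_eq_iff divide_simps)

lemma norm_coupling_power2:
  "(norm (coupling chi m y (k, j)))\<^sup>2 = (amplitude chi k * (cross3 k (axis m 1) $ j / norm k))\<^sup>2"
proof -
  have "norm (Complex (sin (k \<bullet> y)) (cos (k \<bullet> y))) = 1"
    by (simp add: cmod_def)
  then show ?thesis
    by (simp only: coupling_eq norm_mult norm_of_real mult_1_right power2_abs)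
qed

text \<open>Since \<open>k \<wedge> e_m\<close> is no longer than \<open>k\<close>, the radial
  Schwartz weight dominates. Transversality is orthogonality of \<open>k\<close> to its cross
  products, and the cutoff is inherited from \<open>chi\<close>.\<close>

lemma coupling_cut_modes:
  assumes sch: "schwartz chi" and cut: "\<And>k :: real^3. norm k \<le> \<rho> \<Longrightarrow> chi (norm k) = 0"
  shows "coupling chi m y \<in> cut_modes \<rho>"
proof -
  have [measurable]: "chi \<in> borel_measurable borel"
    by (rule schwartz_measurable[OF sch])
  have amp [measurable]: "amplitude chi \<in> borel_measurable borel"
    unfolding amplitude_def by measurable
  have slice [measurable]: "(\<lambda>k. coupling chi m y (k, j)) \<in> borel_measurable borel" for j
    unfolding coupling_eq Complex_eq by measurable
  have meas [measurable]: "coupling chi m y \<in> borel_measurable mode_measure"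
    by (rule measurable_mode_measureI) (rule slice)
  have "integrable mode_measure (\<lambda>q. (norm (coupling chi m y q))\<^sup>2)"
  proof (rule integrable_modeI)
    fix j
    have "integrable lborel (\<lambda>k::real^3. (chi (norm k))\<^sup>2 * norm k / (2 * pi) ^ 3)"
      using integrable_schwartz_weight[OF sch] by simp
    then show "integrable lborel (\<lambda>k. (norm (coupling chi m y (k, j)))\<^sup>2)"
    proof (rule Bochner_Integration.integrable_bound)
      have "(norm (coupling chi m y (k, j)))\<^sup>2 \<le> (chi (norm k))\<^sup>2 * norm k / (2 * pi) ^ 3" for k
      proof -
        have "\<bar>cross3 k (axis m 1) $ j\<bar> \<le> norm k"
          using component_le_norm_cart norm_cross3_axis_le order_trans by blast
        then have "\<bar>cross3 k (axis m 1) $ j / norm k\<bar> \<le> 1"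
          by (simp add: divide_le_eq)
        then have "(cross3 k (axis m 1) $ j / norm k)\<^sup>2 \<le> 1"
          by (simp only: abs_square_le_1)
        then have "(amplitude chi k)\<^sup>2 * (cross3 k (axis m 1) $ j / norm k)\<^sup>2 \<le> (amplitude chi k)\<^sup>2"
          by (intro mult_left_le) auto
        then show ?thesis
          by (simp only: norm_coupling_power2 power_mult_distrib amplitude_power2)
      qed
      then show "AE k in lborel. norm ((norm (coupling chi m y (k, j)))\<^sup>2)
          \<le> norm ((chi (norm k))\<^sup>2 * norm k / (2 * pi) ^ 3)"
        by simp
    qed measurable
  qed measurable
  moreover have "(\<Sum>j\<in>UNIV. of_real (k $ j) * coupling chi m y (k, j)) = 0" for k
  proof -
    have "(\<Sum>j\<in>UNIV. of_real (k $ j) * coupling chi m y (k, j))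
        = of_real (k \<bullet> cross3 k (axis m 1)) *
          (of_real (amplitude chi k / norm k) * Complex (sin (k \<bullet> y)) (cos (k \<bullet> y)))"
      by (simp add: coupling_eq inner_vec_def[of k "cross3 k _"] sum_distrib_left sum_distrib_right
          sum_divide_distrib mult_ac)
    then show ?thesis
      by (simp add: dot_cross_self)
  qed
  moreover have "coupling chi m y q = 0" if "norm (fst q) \<le> \<rho>" for q
    using cut[OF that] by (cases q) (simp add: coupling_eq amplitude_def)
  ultimately show ?thesis
    by (simp add: cut_modes_def)
qed

lemma sum_cnj_coupling_mult:
  "(\<Sum>j\<in>UNIV. cnj (coupling chi m y (k, j)) * coupling chi n z (k, j))
    = of_real ((chi (norm k))\<^sup>2 * norm k / (2 * pi) ^ 3 *
        ((cross3 k (axis m 1) \<bullet> cross3 k (axis n 1)) / (norm k)\<^sup>2)) * cis (k \<bullet> (y - z))"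
proof -
  have cis: "cnj (Complex (sin (k \<bullet> y)) (cos (k \<bullet> y))) * Complex (sin (k \<bullet> z)) (cos (k \<bullet> z)) = cis (k \<bullet> (y - z))"
    by (simp add: complex_eq_iff inner_diff_right cos_diff sin_diff)
  have "(\<Sum>j\<in>UNIV. cnj (coupling chi m y (k, j)) * coupling chi n z (k, j))
    = (\<Sum>j\<in>UNIV. of_real ((amplitude chi k)\<^sup>2 / (norm k)\<^sup>2 * (cross3 k (axis m 1) $ j * cross3 k (axis n 1) $ j)) *
        cis (k \<bullet> (y - z)))"
    unfolding cis[symmetric] by (intro sum.cong refl) (simp add: coupling_eq power2_eq_square mult_ac)
  also have "\<dots> = of_real ((amplitude chi k)\<^sup>2 / (norm k)\<^sup>2 * (cross3 k (axis m 1) \<bullet> cross3 k (axis n 1))) *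
        cis (k \<bullet> (y - z))"
    by (simp only: inner_vec_def inner_real_def sum_distrib_right sum_distrib_left of_real_sum)
  finally show ?thesis
    by (simp add: amplitude_power2)
qed

lemma integral_cnj_coupling_mult:
  assumes sch: "schwartz chi" and cut: "\<And>k :: real^3. norm k \<le> \<rho> \<Longrightarrow> chi (norm k) = 0"
    and \<rho>: "\<rho> > 0" and c: "c \<ge> 0"
  shows "(LINT q|mode_measure. cnj (coupling chi m y q / of_real (norm (fst q) + c)) * coupling chi n z q)
    = of_real (1 / (2 * pi) ^ 3 * (LINT k|lborel. (chi (norm k))\<^sup>2 * norm k / (norm k + c) * cos (k \<bullet> (y - z))
        * ((cross3 k (axis m 1) \<bullet> cross3 k (axis n 1)) / (norm k)\<^sup>2)))"
proof -
  let ?f = "\<lambda>q. cnj (coupling chi m y q / of_real (norm (fst q) + c)) * coupling chi n z q"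
  \<comment> \<open>\<open>W\<close> is real, and even because \<open>k\<close> enters through its
    norm and through two cross products; hence its product with the sine is odd.\<close>
  define W where "W k = 1 / (2 * pi) ^ 3 * ((chi (norm k))\<^sup>2 * norm k / (norm k + c)
        * ((cross3 k (axis m 1) \<bullet> cross3 k (axis n 1)) / (norm k)\<^sup>2))" for k
  have [measurable]: "chi \<in> borel_measurable borel"
    by (rule schwartz_measurable[OF sch])
  have [measurable]: "W \<in> borel_measurable borel"
    unfolding W_def by measurable
  have int: "integrable mode_measure ?f"
    by (intro integrable_cnj_mult[OF divide_energy_cut_modes[OF _ \<rho> c]] coupling_cut_modes[OF sch cut])
  have sum_eq: "(\<Sum>j\<in>UNIV. ?f (k, j)) = of_real (W k) * cis (k \<bullet> (y - z))" for k
  proof -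
    have "(\<Sum>j\<in>UNIV. ?f (k, j))
        = (\<Sum>j\<in>UNIV. cnj (coupling chi m y (k, j)) * coupling chi n z (k, j)) / of_real (norm k + c)"
      unfolding sum_divide_distrib by (intro sum.cong refl) simp
    also have "\<dots> = of_real (W k) * cis (k \<bullet> (y - z))"
      unfolding sum_cnj_coupling_mult W_def by (simp add: mult_ac)
    finally show ?thesis .
  qed
  let ?g = "\<lambda>k. of_real (W k) * cis (k \<bullet> (y - z))"
  have g: "integrable lborel ?g"
    using integrable_mode_sum[OF int] by (simp only: sum_eq)
  have "(LINT q|mode_measure. ?f q) = (LINT k|lborel. ?g k)"
    using integral_mode[OF int] by (simp only: sum_eq)
  also have "\<dots> = of_real (LINT k|lborel. W k * cos (k \<bullet> (y - z)))"
  proof (rule complex_eqI)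
    have "Re (LINT k|lborel. ?g k) = (LINT k|lborel. Re (?g k))"
      by (rule integral_Re[OF g, symmetric])
    then show "Re (LINT k|lborel. ?g k) = Re (of_real (LINT k|lborel. W k * cos (k \<bullet> (y - z))))"
      by simp
    have "(LINT k|lborel. W k * sin (k \<bullet> (y - z))) = 0"
      by (rule integral_lborel_odd) (simp_all add: W_def cross_minus_left)
    moreover have "Im (LINT k|lborel. ?g k) = (LINT k|lborel. Im (?g k))"
      by (rule integral_Im[OF g, symmetric])
    ultimately show "Im (LINT k|lborel. ?g k) = Im (of_real (LINT k|lborel. W k * cos (k \<bullet> (y - z))))"
      by simp
  qed
  also have "(LINT k|lborel. W k * cos (k \<bullet> (y - z)))
      = 1 / (2 * pi) ^ 3 * (LINT k|lborel. (chi (norm k))\<^sup>2 * norm k / (norm k + c) * cos (k \<bullet> (y - z))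
        * ((cross3 k (axis m 1) \<bullet> cross3 k (axis n 1)) / (norm k)\<^sup>2))"
    unfolding integral_mult_right_zero[symmetric] W_def
    by (intro Bochner_Integration.integral_cong refl) (simp add: mult_ac)
  finally show ?thesis .
qed

text \<open>The inner products for (1,2), (2,2) and (1,1) are - k_1 k_2, k_1^2 + k_3^2 and k_2^2 +
  k_3^2. The quarter turn negates the first and exchanges the other two, while radial factors stay
  fixed.\<close>

lemma
  fixes g :: "real \<Rightarrow> real"
  assumes [measurable]: "g \<in> borel_measurable borel"
  shows integral_radial_cross3_12:
      "(LINT k|lborel. g (norm k) * ((cross3 k (axis 1 1) \<bullet> cross3 k (axis 2 1)) / (norm k)\<^sup>2)) = 0"
    and integral_radial_cross3_22:
      "(LINT k|lborel. g (norm k) * ((cross3 k (axis 2 1) \<bullet> cross3 k (axis 2 1)) / (norm k)\<^sup>2))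
      = (LINT k|lborel. g (norm k) * ((cross3 k (axis 1 1) \<bullet> cross3 k (axis 1 1)) / (norm k)\<^sup>2))"
proof -
  let ?F = "\<lambda>m n k. g (norm k) * ((cross3 k (axis m 1) \<bullet> cross3 k (axis n 1)) / (norm k)\<^sup>2)"
  have turn: "(LINT k|lborel. ?F m n (quarter_turn k)) = (LINT k|lborel. ?F m n k)" for m n
    by (rule integral_quarter_turn) measurable
  have "?F 1 2 (quarter_turn k) = - ?F 1 2 k" for k
    by (simp add: cross3_axis inner_vec_def sum_3)
  then show "(LINT k|lborel. ?F 1 2 k) = 0"
    using turn[of 1 2] by simp
  have F22: "?F 2 2 (quarter_turn k) = ?F 1 1 k" for k
    by (simp add: cross3_axis inner_vec_def sum_3 add.commute)
  then show "(LINT k|lborel. ?F 2 2 k) = (LINT k|lborel. ?F 1 1 k)"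
    using turn[of 2 2] by (simp only: F22)
qed

text \<open>The ground state \<open>a_\<emptyset>\<close> is carried by the constant configuration \<open>2\<close>, and \<open>\<sigma>_m\<close> on the \<open>l\<close>-th
  factor maps it to \<open>flip_coeff m\<close> times the product vector of the configuration \<open>ground_flip l m\<close>.\<close>

definition ground_flip :: "'n \<Rightarrow> 3 \<Rightarrow> 'n \<Rightarrow> 2" where
  "ground_flip l m = (if m = 3 then (\<lambda>_. 2) else (\<lambda>_. 2)(l := 1))"

definition flip_coeff :: "3 \<Rightarrow> complex" where
  "flip_coeff m = (if m = 3 then - 1 else pauli m $ 1 $ 2)"

text \<open>For \<open>m = 3\<close> the configuration forgets \<open>l\<close>, which is why
  \<open>C 3 3\<close> couples distinct particles; flips at distinct sites give distinct basis
  vectors.\<close>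

lemma ground_flip_eq_iff:
  "ground_flip l m = ground_flip l' n \<longleftrightarrow> (m = 3 \<and> n = 3 \<or> m \<noteq> 3 \<and> n \<noteq> 3 \<and> l = l')"
  by (auto simp: ground_flip_def fun_eq_iff)

lemma spin_gap_ground_flip: "spin_gap \<beta> (ground_flip l m) = (if m = 3 then 0 else 2 * norm \<beta>)"
proof -
  have "{l'. ground_flip l m l' = 1} = (if m = 3 then {} else {l})"
    by (auto simp: ground_flip_def)
  then show ?thesis
    by (simp add: spin_gap_def)
qed

text \<open>In the upper component the eigenvalue equation says that a number equals its negative.
  The phase of \<open>b $ 2\<close> remains free.\<close>

lemma zeeman_ground_spinor:
  assumes \<beta>: "\<beta> = vector [0, 0, norm \<beta>]" "\<beta> \<noteq> 0"
    and b: "norm b = 1" "(\<Sum>m\<in>UNIV. of_real (\<beta> $ m) *s (pauli m *v b)) = - (of_real (norm \<beta>) *s b)"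
  shows "b $ 1 = 0" "norm (b $ 2) = 1"
proof -
  have \<beta>_nth: "\<beta> $ 1 = 0" "\<beta> $ 2 = 0" "\<beta> $ 3 = norm \<beta>"
    by (subst \<beta>(1), simp)+
  have "(\<Sum>m\<in>UNIV. of_real (\<beta> $ m) *s (pauli m *v b)) $ 1 = of_real (norm \<beta>) * b $ 1"
    by (simp add: sum_3 \<beta>_nth matrix_vector_mult_def sum_2 pauli_3)
  then have "of_real (norm \<beta>) * b $ 1 = - (of_real (norm \<beta>) * b $ 1)"
    unfolding b(2) by simp
  then show "b $ 1 = 0"
    using \<beta>(2) by simp
  then show "norm (b $ 2) = 1"
    using b(1) by (simp add: norm_vec_def L2_set_def sum_2)
qed

lemma spin_power_ground:
  assumes "b $ 1 = 0"
  shows "(spin_power b :: 'n::finite spin) s = (if s = (\<lambda>_. 2) then (b $ 2) ^ CARD('n) else 0)"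
proof (cases "s = (\<lambda>_. 2)")
  case False
  then obtain l where "s l = 1"
    using exhaust_2 by blast
  then have "b $ s l = 0"
    using assms by simp
  then show ?thesis
    using False by (auto simp: spin_power_def)
qed (simp add: spin_power_def)

lemma spin_op_ground:
  assumes "b $ 1 = 0"
  shows "spin_op l m (spin_power b :: 'n::finite spin) s
    = (if s = ground_flip l m then flip_coeff m * (b $ 2) ^ CARD('n) else 0)"
proof (cases "m = 3")
  case True
  then show ?thesis
    by (simp add: spin_op_3 spin_power_ground[OF assms] ground_flip_def flip_coeff_def)
next
  case False
  then have diag: "pauli m $ i $ i = 0" for i
    using exhaust_3[of m] exhaust_2[of i] by (auto simp: pauli_def)
  \<comment> \<open>Only the summand \<open>t = 2\<close> can reach the ground configuration, and
    the zero diagonal then forces \<open>s l = 1\<close>.\<close>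
  have "s(l := 2) = (\<lambda>_. 2) \<and> s l = 1 \<longleftrightarrow> s = ground_flip l m"
    using False by (auto simp: ground_flip_def fun_eq_iff)
  moreover have "s(l := 1) \<noteq> (\<lambda>_. 2)"
    by (auto simp: fun_eq_iff)
  ultimately show ?thesis
    using False exhaust_2[of "s l"]
    by (auto simp: spin_op_def sum_2 spin_power_ground[OF assms] diag flip_coeff_def)
qed

text \<open>Here the arbitrary choice inside \<open>resolvent\<close> disappears: the right-hand
  side involves explicit functions only.\<close>

lemma state_inner_resolvent_one_particle:
  fixes g h :: "('n::finite \<Rightarrow> 2) \<Rightarrow> mode \<Rightarrow> complex"
  assumes \<beta>: "\<beta> = vector [0, 0, norm \<beta>]" and \<rho>: "\<rho> > 0" and z: "z = - real CARD('n) * norm \<beta>"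
    and g: "\<And>s. g s \<in> cut_modes \<rho>" and h: "\<And>s. h s \<in> cut_modes \<rho>"
  shows "state_inner (resolvent \<rho> \<beta> z (one_particle g)) (one_particle h)
    = (\<Sum>s\<in>UNIV. LINT q|mode_measure. cnj (g s q / of_real (norm (fst q) + spin_gap \<beta> s)) * h s q)"
proof (rule state_inner_one_particle)
  note odd = one_particle_odd_states[OF g]
  show "resolvent \<rho> \<beta> z (one_particle g) \<in> odd_states \<rho>"
    by (rule resolvent_odd_states[OF \<beta> odd \<rho> z])
  show "state_eq (resolvent \<rho> \<beta> z (one_particle g))
      (one_particle (\<lambda>s q. g s q / of_real (norm (fst q) + spin_gap \<beta> s)))"
    using resolvent_eq_divide_energy[OF \<beta> odd \<rho> z] by (simp only: divide_energy_one_particle)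
  show "(\<lambda>q. g s q / of_real (norm (fst q) + spin_gap \<beta> s)) \<in> borel_measurable mode_measure" for s
    by (intro cut_modesD(1)[OF divide_energy_cut_modes[OF g \<rho>]]) simp
  show "h s \<in> borel_measurable mode_measure" for s
    by (rule cut_modesD(1)[OF h])
qed

text \<open>The chosen representatives need not add up pointwise, so additivity in both arguments is
  read off from the integral formula.\<close>

lemma state_inner_resolvent_sum:
  fixes e :: "'i \<Rightarrow> ('n::finite \<Rightarrow> 2) \<Rightarrow> mode \<Rightarrow> complex"
  assumes \<beta>: "\<beta> = vector [0, 0, norm \<beta>]" and \<rho>: "\<rho> > 0" and z: "z = - real CARD('n) * norm \<beta>"
    and e: "\<And>i s. e i s \<in> cut_modes \<rho>"
  shows "state_inner (resolvent \<rho> \<beta> z (one_particle (\<lambda>s q. \<Sum>i\<in>A. e i s q))) (one_particle (\<lambda>s q. \<Sum>i\<in>A. e i s q))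
    = (\<Sum>i\<in>A. \<Sum>j\<in>A. state_inner (resolvent \<rho> \<beta> z (one_particle (e i))) (one_particle (e j)))"
proof -
  let ?J = "\<lambda>i j s q. cnj (e i s q / of_real (norm (fst q) + spin_gap \<beta> s)) * e j s q"
  have int: "integrable mode_measure (?J i j s)" for i j s
    by (intro integrable_cnj_mult[OF divide_energy_cut_modes[OF e \<rho>] e]) simp
  have "state_inner (resolvent \<rho> \<beta> z (one_particle (\<lambda>s q. \<Sum>i\<in>A. e i s q))) (one_particle (\<lambda>s q. \<Sum>i\<in>A. e i s q))
    = (\<Sum>s\<in>UNIV. LINT q|mode_measure. cnj ((\<Sum>i\<in>A. e i s q) / of_real (norm (fst q) + spin_gap \<beta> s)) * (\<Sum>i\<in>A. e i s q))"
    by (intro state_inner_resolvent_one_particle[OF \<beta> \<rho> z] sum_cut_modes e)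
  also have "\<dots> = (\<Sum>s\<in>UNIV. LINT q|mode_measure. (\<Sum>i\<in>A. \<Sum>j\<in>A. ?J i j s q))"
    by (simp only: sum_divide_distrib cnj_sum sum_product)
  also have "\<dots> = (\<Sum>s\<in>UNIV. \<Sum>i\<in>A. \<Sum>j\<in>A. LINT q|mode_measure. ?J i j s q)"
    using int by (simp only: Bochner_Integration.integral_sum Bochner_Integration.integrable_sum)
  also have "\<dots> = (\<Sum>i\<in>A. \<Sum>j\<in>A. \<Sum>s\<in>UNIV. LINT q|mode_measure. ?J i j s q)"
    by (subst sum.swap, intro sum.cong refl) (rule sum.swap)
  also have "\<dots> = (\<Sum>i\<in>A. \<Sum>j\<in>A. state_inner (resolvent \<rho> \<beta> z (one_particle (e i))) (one_particle (e j)))"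
    by (simp only: state_inner_resolvent_one_particle[OF \<beta> \<rho> z e e])
  finally show ?thesis .
qed

lemma numeral_3_distinct: "(1::3) \<noteq> 2" "(2::3) \<noteq> 1" "(1::3) \<noteq> 3" "(3::3) \<noteq> 1" "(2::3) \<noteq> 3" "(3::3) \<noteq> 2"
  by simp_all

theorem mainTheorem14:
  fixes \<beta> :: "real^3" and chi :: "real \<Rightarrow> real" and \<rho> :: real
    and x :: "'n::finite \<Rightarrow> real^3" and b0 :: "complex^2"
    and a0 :: "'n spin" and u0 u1 :: "'n state" and lam1 :: real and lam2 :: complex
    and w :: "3 \<Rightarrow> 'n \<Rightarrow> 'n state" and C :: "3 \<Rightarrow> 3 \<Rightarrow> 'n \<Rightarrow> 'n \<Rightarrow> complex"
  assumes beta: "\<beta> = vector [0, 0, norm \<beta>]" "\<beta> \<noteq> 0"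
    and sch: "schwartz chi"
    and rho: "\<rho> > 0" "\<And>k :: real^3. norm k \<le> \<rho> \<Longrightarrow> chi (norm k) = 0"
    and b0: "norm b0 = 1"
      "(\<Sum>m\<in>UNIV. of_real (\<beta> $ m) *s (pauli m *v b0)) = - (of_real (norm \<beta>) *s b0)"
    and a0: "a0 = spin_power b0"
    and u0: "u0 = tensor vacuum a0"
    and lam1: "lam1 = - real CARD('n) * norm \<beta>"
    and u1: "u1 = (\<lambda>s n p. - resolvent \<rho> \<beta> lam1 (K32 chi x u0) s n p)"
    and lam2: "lam2 = state_inner (K32 chi x u1) u0"
    and w: "w = (\<lambda>m l. tensor (field chi m (x l) vacuum) (spin_op l m a0))"
    and C: "C = (\<lambda>m n l l'. state_inner (resolvent \<rho> \<beta> lam1 (w m l)) (w n l'))"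
  shows
    "(\<forall>f \<in> (odd_states \<rho> :: 'n state set). \<exists>u \<in> odd_states \<rho>. state_eq (K1_shift \<beta> lam1 u) f \<and>
        (\<forall>v \<in> odd_states \<rho>. state_eq (K1_shift \<beta> lam1 v) f \<longrightarrow> state_eq v u))
     \<and> K32 chi x u0 \<in> odd_states \<rho>
     \<and> (\<forall>m l. w m l \<in> odd_states \<rho>)
     \<and> u1 \<in> odd_states \<rho>
     \<and> state_eq (\<lambda>s n p. K1_shift \<beta> lam1 u1 s n p + K32 chi x u0 s n p) (\<lambda>s n p. 0)
     \<and> lam2 = - state_inner (resolvent \<rho> \<beta> lam1 (K32 chi x u0)) (K32 chi x u0)
     \<and> lam2 = - (\<Sum>l\<in>UNIV. \<Sum>l'\<in>UNIV. \<Sum>m\<in>UNIV. \<Sum>n\<in>UNIV. C m n l l')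
     \<and> (\<forall>m n l l'. \<not> (m = 3 \<and> n = 3 \<or> m \<in> {1, 2} \<and> n \<in> {1, 2} \<and> l = l') \<longrightarrow> C m n l l' = 0)
     \<and> (\<forall>l l'. C 3 3 l l' = of_real (1/2 * (1 / (2 * pi) ^ 3 *
          (LINT k|lborel. (chi (norm k))\<^sup>2 * cos (k \<bullet> (x l - x l'))
             * (((k $ 1)\<^sup>2 + (k $ 2)\<^sup>2) / (norm k)\<^sup>2)))))
     \<and> (\<forall>m \<in> {1, 2}. \<forall>n \<in> {1, 2}. \<forall>l. C m n l l =
          spin_inner (spin_op l m a0) (spin_op l n a0) * of_real (1/2 * (1 / (2 * pi) ^ 3 *
          (LINT k|lborel. (chi (norm k))\<^sup>2 * norm k / (norm k + 2 * norm \<beta>)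
             * ((cross3 k (axis m 1) \<bullet> cross3 k (axis n 1)) / (norm k)\<^sup>2)))))
     \<and> (\<forall>m \<in> {1, 2}. \<forall>n \<in> {1, 2}. m \<noteq> n \<longrightarrow>
          (LINT k|lborel. (chi (norm k))\<^sup>2 * norm k / (norm k + 2 * norm \<beta>)
             * ((cross3 k (axis m 1) \<bullet> cross3 k (axis n 1)) / (norm k)\<^sup>2)) = 0)
     \<and> (\<forall>l. lam2 = - 2 * of_nat CARD('n) * C 1 1 l l
          - (\<Sum>r\<in>UNIV. \<Sum>r'\<in>UNIV. C 3 3 r r'))"
proof -
  define \<alpha> where "\<alpha> = complex_of_real (1 / sqrt 2)"
  \<comment> \<open>Indexing by pairs (particle, Pauli index) makes \<open>K32 chi x u0\<close> a
    single sum whose terms are exactly the vectors \<open>w\<close>.\<close>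
  define e where "e i s q = \<alpha> * coupling chi (snd i) (x (fst i)) q * spin_op (fst i) (snd i) a0 s" for i s q
  \<comment> \<open>The undetermined phase of \<open>b0\<close> survives only in \<open>c\<close>,
    which has modulus 1 and cancels in every bracket.\<close>
  define c where "c = (b0 $ 2) ^ CARD('n)"
  define U where "U m n y z r = (LINT k|lborel. (chi (norm k))\<^sup>2 * norm k / (norm k + r) * cos (k \<bullet> (y - z))
        * ((cross3 k (axis m 1) \<bullet> cross3 k (axis n 1)) / (norm k)\<^sup>2))" for m n and y z :: "real^3" and r
  have cpl: "coupling chi m y \<in> cut_modes \<rho>" for m y
    by (rule coupling_cut_modes[OF sch rho(2)])
  have e: "e i s \<in> cut_modes \<rho>" for i s
  proof -
    have "e i s = (\<lambda>q. (\<alpha> * spin_op (fst i) (snd i) a0 s) * coupling chi (snd i) (x (fst i)) q)"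
      by (simp add: e_def fun_eq_iff)
    then show ?thesis
      by (simp only: cmult_cut_modes[OF cpl])
  qed
  have w_eq: "w m l = one_particle (e (l, m))" for m l
    unfolding w tensor_field_vacuum e_def \<alpha>_def by simp
  have K_eq: "K32 chi x u0 = one_particle (\<lambda>s q. \<Sum>i\<in>UNIV. e i s q)"
    unfolding u0 K32_tensor_vacuum e_def \<alpha>_def by (simp add: sum.cartesian_product case_prod_beta)
  have w_odd: "w m l \<in> odd_states \<rho>" for m l
    unfolding w_eq by (rule one_particle_odd_states[OF e])
  have sum_e: "(\<lambda>q. \<Sum>i\<in>UNIV. e i s q) \<in> cut_modes \<rho>" for s
    by (rule sum_cut_modes[OF e])
  have K_odd: "K32 chi x u0 \<in> odd_states \<rho>"
    unfolding K_eq by (rule one_particle_odd_states[OF sum_e])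
  note R_odd = resolvent_odd_states[OF beta(1) K_odd rho(1) lam1]
  have u1_odd: "u1 \<in> odd_states \<rho>"
    unfolding u1 by (rule uminus_odd_states[OF R_odd])
  have solvable: "\<forall>f \<in> (odd_states \<rho> :: 'n state set). \<exists>u \<in> odd_states \<rho>. state_eq (K1_shift \<beta> lam1 u) f \<and>
        (\<forall>v \<in> odd_states \<rho>. state_eq (K1_shift \<beta> lam1 v) f \<longrightarrow> state_eq v u)"
    unfolding lam1
    using divide_energy_odd_states[OF _ rho(1)] K1_shift_divide_energy[OF beta(1) _ rho(1)]
      K1_shift_unique[OF beta(1) rho(1)] by blast
  have first_order: "state_eq (\<lambda>s n p. K1_shift \<beta> lam1 u1 s n p + K32 chi x u0 s n p) (\<lambda>s n p. 0)"
    unfolding state_eq_def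
  proof (intro allI)
    fix s m
    have "AE p in sector_measure m. K1_shift \<beta> lam1 (resolvent \<rho> \<beta> lam1 (K32 chi x u0)) s m p = K32 chi x u0 s m p"
      using K1_shift_resolvent[OF beta(1) K_odd rho(1) lam1] unfolding state_eq_def by blast
    then show "AE p in sector_measure m. K1_shift \<beta> lam1 u1 s m p + K32 chi x u0 s m p = 0"
      by eventually_elim (simp add: u1 lam1 K1_shift_eq_mult[OF beta(1), simplified])
  qed
  \<comment> \<open>The explicit representative of \<open>u1\<close>: minus the source divided by
    its energy.\<close>
  define g where "g s q = - ((\<Sum>i\<in>UNIV. e i s q) / of_real (norm (fst q) + spin_gap \<beta> s))" for s q
  have g: "g s \<in> cut_modes \<rho>" for s
    using cmult_cut_modes[OF divide_energy_cut_modes[OF sum_e rho(1) spin_gap_nonneg], of "- 1"]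
    unfolding g_def by simp
  have u1_eq: "state_eq u1 (one_particle g)"
    unfolding state_eq_def
  proof (intro allI)
    fix s m
    have "AE p in sector_measure m. resolvent \<rho> \<beta> lam1 (K32 chi x u0) s m p
        = one_particle (\<lambda>s q. (\<Sum>i\<in>UNIV. e i s q) / of_real (norm (fst q) + spin_gap \<beta> s)) s m p"
      using resolvent_eq_divide_energy[OF beta(1) K_odd rho(1) lam1]
      unfolding state_eq_def K_eq divide_energy_one_particle by blast
    then show "AE p in sector_measure m. u1 s m p = one_particle g s m p"
      by eventually_elim (simp add: u1 one_particle_def g_def)
  qed
  have "lam2 = state_inner u1 (K32 chi x u0)"
    unfolding lam2 u0 by (rule state_inner_K32_vacuum[OF u1_odd u1_eq g cpl])
  also have "\<dots> = (\<Sum>s\<in>UNIV. LINT q|mode_measure. cnj (g s q) * (\<Sum>i\<in>UNIV. e i s q))"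
    unfolding K_eq
    by (rule state_inner_one_particle[OF u1_odd u1_eq cut_modesD(1)[OF g] cut_modesD(1)[OF sum_e]])
  also have "\<dots> = - (\<Sum>s\<in>UNIV. LINT q|mode_measure.
      cnj ((\<Sum>i\<in>UNIV. e i s q) / of_real (norm (fst q) + spin_gap \<beta> s)) * (\<Sum>i\<in>UNIV. e i s q))"
    by (simp only: g_def complex_cnj_minus mult_minus_left Bochner_Integration.integral_minus sum_negf)
  also have "\<dots> = - state_inner (resolvent \<rho> \<beta> lam1 (K32 chi x u0)) (K32 chi x u0)"
    unfolding K_eq state_inner_resolvent_one_particle[OF beta(1) rho(1) lam1 sum_e sum_e] ..
  finally have lam2_resolvent: "lam2 = - state_inner (resolvent \<rho> \<beta> lam1 (K32 chi x u0)) (K32 chi x u0)" .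
  have C_eq: "C m n l l' = state_inner (resolvent \<rho> \<beta> lam1 (one_particle (e (l, m)))) (one_particle (e (l', n)))"
    for m n l l'
    by (simp add: C w_eq)
  have "state_inner (resolvent \<rho> \<beta> lam1 (K32 chi x u0)) (K32 chi x u0)
      = (\<Sum>(l, m)\<in>UNIV \<times> UNIV. \<Sum>(l', n)\<in>UNIV \<times> UNIV. C m n l l')"
    unfolding K_eq state_inner_resolvent_sum[OF beta(1) rho(1) lam1 e] C_eq
    by (simp add: case_prod_beta)
  also have "\<dots> = (\<Sum>l\<in>UNIV. \<Sum>m\<in>UNIV. \<Sum>l'\<in>UNIV. \<Sum>n\<in>UNIV. C m n l l')"
    by (simp only: sum.cartesian_product[symmetric])
  also have "\<dots> = (\<Sum>l\<in>UNIV. \<Sum>l'\<in>UNIV. \<Sum>m\<in>UNIV. \<Sum>n\<in>UNIV. C m n l l')"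
    by (intro sum.cong refl sum.swap)
  finally have lam2_sum: "lam2 = - (\<Sum>l\<in>UNIV. \<Sum>l'\<in>UNIV. \<Sum>m\<in>UNIV. \<Sum>n\<in>UNIV. C m n l l')"
    using lam2_resolvent by simp
  note ground = zeeman_ground_spinor[OF beta b0]
  have spin: "spin_op l m a0 s = (if s = ground_flip l m then flip_coeff m * c else 0)" for l m s
    unfolding a0 c_def by (rule spin_op_ground[OF ground(1)])
  have c1: "cnj c * c = 1"
    using ground(2) complex_norm_square[of c] by (simp add: c_def norm_power mult.commute)
  have \<alpha>: "cnj \<alpha> * \<alpha> = of_real (1/2)"
    by (simp add: \<alpha>_def flip: of_real_mult)
  have integral: "(LINT q|mode_measure. cnj (coupling chi m y q / of_real (norm (fst q) + r)) * coupling chi n z q)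
      = of_real (1 / (2 * pi) ^ 3 * U m n y z r)" if "r \<ge> 0" for m n y z r
    unfolding U_def by (rule integral_cnj_coupling_mult[OF sch rho(2) rho(1) that])
  \<comment> \<open>One formula covers all brackets: the sum over \<open>s\<close> has at most one
    non-zero term, at the common flipped configuration. There the moduli of \<open>\<alpha>\<close>
    and \<open>c\<close> contribute 1/2 and 1.\<close>
  have C_value: "C m n l l' = (if ground_flip l m = ground_flip l' n
      then cnj (flip_coeff m) * flip_coeff n *
        of_real (1/2 * (1 / (2 * pi) ^ 3 * U m n (x l) (x l') (spin_gap \<beta> (ground_flip l m)))) else 0)"
    for m n l l'
  proof -
    have "C m n l l' = (\<Sum>s\<in>UNIV. LINT q|mode_measure.
        cnj (e (l, m) s q / of_real (norm (fst q) + spin_gap \<beta> s)) * e (l', n) s q)"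
      unfolding C_eq by (rule state_inner_resolvent_one_particle[OF beta(1) rho(1) lam1 e e])
    also have "\<dots> = (\<Sum>s\<in>UNIV. LINT q|mode_measure. ((cnj \<alpha> * \<alpha>) * (cnj (spin_op l m a0 s) * spin_op l' n a0 s)) *
        (cnj (coupling chi m (x l) q / of_real (norm (fst q) + spin_gap \<beta> s)) * coupling chi n (x l') q))"
      by (simp add: e_def mult_ac)
    also have "\<dots> = (\<Sum>s\<in>UNIV. ((cnj \<alpha> * \<alpha>) * (cnj (spin_op l m a0 s) * spin_op l' n a0 s)) *
        of_real (1 / (2 * pi) ^ 3 * U m n (x l) (x l') (spin_gap \<beta> s)))"
      by (simp only: integral_mult_right_zero integral[OF spin_gap_nonneg])
    also have "\<dots> = (\<Sum>s\<in>UNIV. if s = ground_flip l m then (if ground_flip l m = ground_flip l' n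
        then (cnj \<alpha> * \<alpha>) * (cnj c * c) * (cnj (flip_coeff m) * flip_coeff n) *
        of_real (1 / (2 * pi) ^ 3 * U m n (x l) (x l') (spin_gap \<beta> (ground_flip l m))) else 0) else 0)"
      by (intro sum.cong refl) (simp add: spin mult_ac)
    finally show ?thesis
      unfolding c1 \<alpha> by (simp add: mult_ac)
  qed
  have C33: "C 3 3 l l' = of_real (1/2 * (1 / (2 * pi) ^ 3 *
          (LINT k|lborel. (chi (norm k))\<^sup>2 * cos (k \<bullet> (x l - x l'))
             * (((k $ 1)\<^sup>2 + (k $ 2)\<^sup>2) / (norm k)\<^sup>2))))" for l l'
  proof -
    \<comment> \<open>With zero gap the factor \<open>norm k\<close> cancels. At
      \<open>k = 0\<close> both integrands are 0 by the convention for division by zero, so they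
      agree everywhere.\<close>
    have "U 3 3 (x l) (x l') 0 = (LINT k|lborel. (chi (norm k))\<^sup>2 * cos (k \<bullet> (x l - x l'))
             * (((k $ 1)\<^sup>2 + (k $ 2)\<^sup>2) / (norm k)\<^sup>2))"
      unfolding U_def
      by (intro Bochner_Integration.integral_cong refl)
        (simp add: cross3_axis inner_vec_def sum_3 power2_eq_square add.commute)
    then show ?thesis
      by (simp add: C_value ground_flip_eq_iff spin_gap_ground_flip flip_coeff_def)
  qed
  have spin_inner_eq: "spin_inner (spin_op l m a0) (spin_op l n a0) = cnj (flip_coeff m) * flip_coeff n"
    if "m \<noteq> 3" "n \<noteq> 3" for l m n
  proof -
    have same: "ground_flip l m = ground_flip l n"
      using that by (simp add: ground_flip_eq_iff)
    have "spin_inner (spin_op l m a0) (spin_op l n a0)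
        = (\<Sum>s\<in>UNIV. if s = ground_flip l n then (cnj c * c) * (cnj (flip_coeff m) * flip_coeff n) else 0)"
      unfolding spin_inner_def by (intro sum.cong refl) (simp add: spin same mult_ac)
    then show ?thesis
      by (simp add: c1)
  qed
  have Cmn: "C m n l l = spin_inner (spin_op l m a0) (spin_op l n a0) * of_real (1/2 * (1 / (2 * pi) ^ 3 *
          (LINT k|lborel. (chi (norm k))\<^sup>2 * norm k / (norm k + 2 * norm \<beta>)
             * ((cross3 k (axis m 1) \<bullet> cross3 k (axis n 1)) / (norm k)\<^sup>2))))"
    if "m \<noteq> 3" "n \<noteq> 3" for l m n
    using that
    by (simp add: C_value ground_flip_eq_iff spin_gap_ground_flip spin_inner_eq U_def)
  have [measurable]: "chi \<in> borel_measurable borel"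
    by (rule schwartz_measurable[OF sch])
  have weight: "(\<lambda>r. (chi r)\<^sup>2 * r / (r + 2 * norm \<beta>)) \<in> borel_measurable borel"
    by measurable
  have zero12: "(LINT k|lborel. (chi (norm k))\<^sup>2 * norm k / (norm k + 2 * norm \<beta>)
             * ((cross3 k (axis 1 1) \<bullet> cross3 k (axis 2 1)) / (norm k)\<^sup>2)) = 0"
    by (rule integral_radial_cross3_12[OF weight])
  then have zero: "(LINT k|lborel. (chi (norm k))\<^sup>2 * norm k / (norm k + 2 * norm \<beta>)
             * ((cross3 k (axis m 1) \<bullet> cross3 k (axis n 1)) / (norm k)\<^sup>2)) = 0"
    if "m \<in> {1, 2}" "n \<in> {1, 2}" "m \<noteq> n" for m n
    using that by (auto simp: inner_commute)
  \<comment> \<open>The flip coefficients 1 and - i have equal modulus, and the quarter turn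
    identifies the integrals.\<close>
  have C22: "C 2 2 l l = C 1 1 l l" for l
    by (simp only: Cmn numeral_3_distinct not_False_eq_True spin_inner_eq integral_radial_cross3_22[OF weight])
      (simp add: flip_coeff_def pauli_def)
  have C11_const: "C 1 1 l l = C 1 1 r r" for l r
    by (simp only: Cmn numeral_3_distinct not_False_eq_True spin_inner_eq)
  have C_zero: "C m n l l' = 0"
    if "\<not> (m = 3 \<and> n = 3 \<or> m \<in> {1, 2} \<and> n \<in> {1, 2} \<and> l = l')" for m n l l'
    using that exhaust_3[of m] exhaust_3[of n] by (auto simp: C_value ground_flip_eq_iff)
  \<comment> \<open>The spin factor is not zero here: both operators flip the same spin. It is the
    integral that vanishes.\<close>
  have C12: "C 1 2 l l = 0" "C 2 1 l l = 0" for l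
    using zero[of 1 2] zero[of 2 1]
    by (simp_all only: Cmn numeral_3_distinct not_False_eq_True insert_iff simp_thms mult_zero_right of_real_0)
  have lam2_final: "lam2 = - 2 * of_nat CARD('n) * C 1 1 l l - (\<Sum>r\<in>UNIV. \<Sum>r'\<in>UNIV. C 3 3 r r')" for l
  proof -
    \<comment> \<open>Equal particles contribute \<open>C 1 1\<close>, \<open>C 2 2\<close> and
      \<open>C 3 3\<close>, distinct ones only \<open>C 3 3\<close>. Summing over the diagonal pairs
      produces the factor 2N.\<close>
    have "(\<Sum>m\<in>UNIV. \<Sum>n\<in>UNIV. C m n r r') = (if r = r' then 2 * C 1 1 l l else 0) + C 3 3 r r'" for r r'
    proof (cases "r = r'")
      case True
      then show ?thesis
        using C11_const[of r l] by (simp add: sum_3 C12 C22 C_zero)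
    next
      case False
      then show ?thesis
        by (simp add: sum_3 C_zero)
    qed
    then show ?thesis
      unfolding lam2_sum by (simp add: sum.distrib)
  qed
  show ?thesis
    using solvable K_odd w_odd u1_odd first_order lam2_resolvent lam2_sum C_zero C33 Cmn zero lam2_final
    by (intro conjI allI ballI impI) (auto; fail)+
qed

end
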